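(* Let $(\mathfrak M,\Phi,\varphi)$ be a quantum dynamical system with $\varphi$-adjoint $\Phi^\sharp$, and let $\mathfrak D_\infty=\bigcap_{k\in\mathbb Z}\mathfrak D_{\Phi_k}$. Then: (i) $\Phi(\mathfrak D_\infty)\subset\mathfrak D_\infty$, and the map $\Phi_\infty:\mathfrak D_\infty\to\mathfrak D_\infty$, $\Phi_\infty(d)=\Phi(d)$, is a $*$-automorphism of the von Neumann algebra $\mathfrak D_\infty$. (ii) If $\mathfrak B$ is a von Neumann subalgebra of $\mathfrak M$ such that the restriction of $\Phi$ to $\mathfrak B$ is a $*$-automorphism of $\mathfrak B$, then $\mathfrak B\subset\mathfrak D_\infty$. (iii) $(\mathfrak D_\infty,\Phi_\infty,\varphi_\infty)$ is a quantum dynamical system (with dynamics a $*$-automorphism), where the normal state $\varphi_\infty$ is the restriction of $\varphi$ to $\mathfrak D_\infty$, and the $\varphi_\infty$-adjoint $\Phi_\infty^\sharp$ of $\Phi_\infty$ is the restriction of $\Phi^\sharp$ to $\mathfrak D_\infty$.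
   Context: A unital Schwartz map on a von Neumann algebra $\mathfrak M$ is an ultraweakly continuous linear map $\Phi:\mathfrak M\to\mathfrak M$ with $\Phi(1)=1$ and $0\le\Phi(a^* )\Phi(a)\le\Phi(a^*a)$ for all $a\in\mathfrak M$. A quantum dynamical system $(\mathfrak M,\Phi,\varphi)$ consists of a von Neumann algebra $\mathfrak M$, a unital Schwartz map $\Phi$ on $\mathfrak M$, and a normal faithful state $\varphi$ on $\mathfrak M$ with $\varphi\circ\Phi=\varphi$, such that $\Phi$ admits a $\varphi$-adjoint, i.e. a normal unital Schwartz map $\Phi^\sharp:\mathfrak M\to\mathfrak M$ with $\varphi(b\Phi(a))=\varphi(\Phi^\sharp(b)a)$ for all $a,b\in\mathfrak M$. For a unital Schwartz map $\Psi$, its multiplicative domain is $\mathfrak D_\Psi=\{a\in\mathfrak M:\Psi(a^*a)=\Psi(a^* )\Psi(a)\text{ and }\Psi(aa^* )=\Psi(a)\Psi(a^* )\}$, a von Neumann algebra. For $k\in\mathbb Z$, $\Phi_k=\Phi^k$ if $k\ge0$ and $\Phi_k=(\Phi^\sharp)^{|k|}$ if $k<0$. *)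

theory Defs
  imports "HOL-Analysis.Analysis"
begin

section \<open>Complex Hilbert spaces\<close>

class complex_vector = real_vector +
  fixes scaleC :: "complex \<Rightarrow> 'a \<Rightarrow> 'a"  (infixr "*\<^sub>C" 75)
  assumes scaleC_add_right: "c *\<^sub>C (x + y) = c *\<^sub>C x + c *\<^sub>C y"
    and scaleC_add_left: "(c + d) *\<^sub>C x = c *\<^sub>C x + d *\<^sub>C x"
    and scaleC_scaleC: "c *\<^sub>C d *\<^sub>C x = (c * d) *\<^sub>C x"
    and scaleC_of_real: "complex_of_real r *\<^sub>C x = r *\<^sub>R x"

text \<open>The norm, metric and topology of a Hilbert space are the ones of the underlying real inner
  product space; positive definiteness is inherited from there, as is
  \<open>cinner x x = (norm x)\<^sup>2\<close>. The inner product is conjugate-linear in its first argument.\<close>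

class chilbert_space = complex_vector + real_inner + complete_space +
  fixes cinner :: "'a \<Rightarrow> 'a \<Rightarrow> complex"
  assumes cinner_commute: "cinner x y = cnj (cinner y x)"
    and cinner_add_right: "cinner x (y + z) = cinner x y + cinner x z"
    and cinner_scaleC_right: "cinner x (c *\<^sub>C y) = c * cinner x y"
    and Re_cinner: "Re (cinner x y) = inner x y"

instantiation complex :: chilbert_space
begin

definition scaleC_complex :: "complex \<Rightarrow> complex \<Rightarrow> complex"
  where "scaleC_complex c x = c * x"

definition cinner_complex :: "complex \<Rightarrow> complex \<Rightarrow> complex"
  where "cinner_complex x y = cnj x * y"

instance
  by standard
    (simp_all add: scaleC_complex_def cinner_complex_def inner_complex_def algebra_simps scaleR_conv_of_real)

end

lemma cinner_zero_right [simp]: "cinner x 0 = 0"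
  using cinner_add_right[of x 0 0] by simp

lemma cinner_minus_right: "cinner x (- y) = - cinner x y"
  using cinner_add_right[of x y "- y"] by (simp add: eq_neg_iff_add_eq_0 add.commute)

lemma cinner_diff_right: "cinner x (y - z) = cinner x y - cinner x z"
  using cinner_add_right[of x y "- z"] by (simp add: cinner_minus_right)

lemma cinner_add_left: "cinner (x + y) z = cinner x z + cinner y z"
  by (metis cinner_add_right cinner_commute complex_cnj_add)

lemma cinner_scaleC_left: "cinner (c *\<^sub>C x) y = cnj c * cinner x y"
  by (metis cinner_scaleC_right cinner_commute complex_cnj_mult)

lemma scaleC_minus_right: "c *\<^sub>C (- x) = - (c *\<^sub>C (x :: 'a::complex_vector))"
proof -
  have "c *\<^sub>C (0 :: 'a) = 0"
    using scaleC_add_right[of c "0 :: 'a" 0] by simp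
  then show ?thesis
    using scaleC_add_right[of c x "- x"] by (simp add: eq_neg_iff_add_eq_0 add.commute)
qed

lemma scaleC_diff_right: "c *\<^sub>C (x - y) = c *\<^sub>C x - c *\<^sub>C (y :: 'a::complex_vector)"
  using scaleC_add_right[of c x "- y"] by (simp add: scaleC_minus_right)

lemma bounded_linear_scaleC: "bounded_linear (\<lambda>x :: 'h::chilbert_space. c *\<^sub>C x)"
proof (rule bounded_linear_intro)
  fix x y :: 'h and r :: real
  show "c *\<^sub>C (x + y) = c *\<^sub>C x + c *\<^sub>C y"
    by (rule scaleC_add_right)
  show "c *\<^sub>C (r *\<^sub>R x) = r *\<^sub>R (c *\<^sub>C x)"
    by (simp add: scaleC_of_real[symmetric] scaleC_scaleC mult.commute)
  have "cinner (c *\<^sub>C x) (c *\<^sub>C x) = of_real ((cmod c)\<^sup>2) * cinner x x"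
    by (simp add: cinner_scaleC_left cinner_scaleC_right mult_ac complex_norm_square del: of_real_power)
  then have "Re (cinner (c *\<^sub>C x) (c *\<^sub>C x)) = (cmod c)\<^sup>2 * Re (cinner x x)"
    by simp
  then have "(norm (c *\<^sub>C x))\<^sup>2 = (norm x * cmod c)\<^sup>2"
    by (simp add: Re_cinner power2_norm_eq_inner power_mult_distrib mult.commute)
  then show "norm (c *\<^sub>C x) \<le> norm x * cmod c"
    by (simp add: power2_eq_iff_nonneg)
qed


section \<open>Bounded operators\<close>

typedef (overloaded) 'h bop =
  "{f :: 'h::chilbert_space \<Rightarrow> 'h. bounded_linear f \<and> (\<forall>c x. f (c *\<^sub>C x) = c *\<^sub>C f x)}"
  morphisms bop_apply Bop
  by (rule exI[of _ "\<lambda>x. x"]) simp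

setup_lifting type_definition_bop

instantiation bop :: (chilbert_space) "{ring, monoid_mult, complex_vector, minus, uminus}"
begin

lift_definition zero_bop :: "'a bop" is "\<lambda>_. 0"
  using scaleC_add_right[of _ "0 :: 'a" 0] by simp

lift_definition one_bop :: "'a bop" is "\<lambda>x. x"
  by simp

lift_definition plus_bop :: "'a bop \<Rightarrow> 'a bop \<Rightarrow> 'a bop" is "\<lambda>f g x. f x + g x"
  by (simp add: bounded_linear_add scaleC_add_right)

lift_definition uminus_bop :: "'a bop \<Rightarrow> 'a bop" is "\<lambda>f x. - f x"
  by (simp add: bounded_linear_minus scaleC_minus_right)

lift_definition minus_bop :: "'a bop \<Rightarrow> 'a bop \<Rightarrow> 'a bop" is "\<lambda>f g x. f x - g x"
  by (auto intro: bounded_linear_sub simp: scaleC_diff_right)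

lift_definition times_bop :: "'a bop \<Rightarrow> 'a bop \<Rightarrow> 'a bop" is "\<lambda>f g x. f (g x)"
  by (simp add: bounded_linear_compose)

lift_definition scaleC_bop :: "complex \<Rightarrow> 'a bop \<Rightarrow> 'a bop" is "\<lambda>c f x. c *\<^sub>C f x"
  by (auto intro: bounded_linear_compose[OF bounded_linear_scaleC] simp: scaleC_scaleC mult.commute)

definition scaleR_bop :: "real \<Rightarrow> 'a bop \<Rightarrow> 'a bop"
  where "scaleR_bop r a = complex_of_real r *\<^sub>C a"

instance
proof
  fix a b c :: "'a bop" and r s :: real and z w :: complex
  show "a + b + c = a + (b + c)" by transfer (simp add: add.assoc)
  show "a + b = b + a" by transfer (simp add: add.commute)
  show "0 + a = a" by transfer simp
  show "- a + a = 0" by transfer simp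
  show "a - b = a + - b" by transfer simp
  show "a * b * c = a * (b * c)" by transfer simp
  show "(a + b) * c = a * c + b * c" by transfer simp
  show "a * (b + c) = a * b + a * c"
    by transfer (auto simp: fun_eq_iff dest!: bounded_linear.linear linear_add)
  show "1 * a = a" by transfer simp
  show "a * 1 = a" by transfer simp
  show C1: "z *\<^sub>C (a + b) = z *\<^sub>C a + z *\<^sub>C b" for z :: complex and a b :: "'a bop"
    by transfer (simp add: scaleC_add_right)
  show C2: "(z + w) *\<^sub>C a = z *\<^sub>C a + w *\<^sub>C a" for z w :: complex and a :: "'a bop"
    by transfer (simp add: scaleC_add_left)
  show C3: "z *\<^sub>C w *\<^sub>C a = (z * w) *\<^sub>C a" for z w :: complex and a :: "'a bop"
    by transfer (simp add: scaleC_scaleC)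
  show "complex_of_real r *\<^sub>C a = r *\<^sub>R a" by (simp add: scaleR_bop_def)
  show "r *\<^sub>R (a + b) = r *\<^sub>R a + r *\<^sub>R b" by (simp add: scaleR_bop_def C1)
  show "(r + s) *\<^sub>R a = r *\<^sub>R a + s *\<^sub>R a" by (simp add: scaleR_bop_def C2)
  show "r *\<^sub>R s *\<^sub>R a = (r * s) *\<^sub>R a" by (simp add: scaleR_bop_def C3)
  show "1 *\<^sub>R a = a"
    unfolding scaleR_bop_def by transfer (simp only: scaleC_of_real scaleR_one)
qed

end

text \<open>Positivity of an operator is positivity of its quadratic form, which over the complex
  numbers includes self-adjointness.\<close>

instantiation bop :: (chilbert_space) order
begin

definition less_eq_bop :: "'a bop \<Rightarrow> 'a bop \<Rightarrow> bool"
  where "a \<le> b \<longleftrightarrow> (\<forall>x. cinner x (bop_apply (b - a) x) \<in> \<real>\<^sub>\<ge>\<^sub>0)"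

definition less_bop :: "'a bop \<Rightarrow> 'a bop \<Rightarrow> bool"
  where "less_bop a b \<longleftrightarrow> a \<le> b \<and> \<not> b \<le> a"

instance
proof
  fix a b c :: "'a bop"
  show "(a < b) = (a \<le> b \<and> \<not> b \<le> a)" by (rule less_bop_def)
  show "a \<le> a" by (simp add: less_eq_bop_def zero_bop.rep_eq)
  show "a \<le> c" if "a \<le> b" "b \<le> c"
    unfolding less_eq_bop_def
  proof
    fix x
    have "cinner x (bop_apply (c - a) x) = cinner x (bop_apply (c - b) x) + cinner x (bop_apply (b - a) x)"
      by (simp add: minus_bop.rep_eq cinner_diff_right)
    then show "cinner x (bop_apply (c - a) x) \<in> \<real>\<^sub>\<ge>\<^sub>0"
      using that by (simp add: less_eq_bop_def nonneg_Reals_add_I)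
  qed
  show "a = b" if ab: "a \<le> b" and ba: "b \<le> a"
  proof -
    define T where "T = bop_apply (b - a)"
    have add: "T (x + y) = T x + T y" for x y
      unfolding T_def using bop_apply[of "b - a"] by (auto dest!: bounded_linear.linear linear_add)
    have scale: "T (z *\<^sub>C x) = z *\<^sub>C T x" for z x
      unfolding T_def using bop_apply[of "b - a"] by auto
    have zero: "cinner x (T x) = 0" for x
    proof -
      have "cinner x (bop_apply (a - b) x) = - cinner x (T x)"
        by (simp add: T_def minus_bop.rep_eq cinner_diff_right)
      moreover have "cinner x (T x) \<in> \<real>\<^sub>\<ge>\<^sub>0" "cinner x (bop_apply (a - b) x) \<in> \<real>\<^sub>\<ge>\<^sub>0"
        using ab ba by (auto simp: less_eq_bop_def T_def)
      ultimately show ?thesis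
        by (auto simp: complex_nonneg_Reals_iff complex_eq_iff)
    qed
    have "T y = 0" for y
    proof -
      have 1: "cinner x (T y) + cinner y (T x) = 0" for x
        using zero[of "x + y"] zero[of x] zero[of y]
        by (simp add: add cinner_add_left cinner_add_right add.commute)
      have 2: "cinner x (T y) = cinner y (T x)" for x
        using 1[of "\<i> *\<^sub>C x"] by (simp add: scale cinner_scaleC_left cinner_scaleC_right)
      have "cinner (T y) (T y) = 0"
        using 1[of "T y"] 2[of "T y"] by simp
      then show ?thesis
        using Re_cinner[of "T y" "T y"] by simp
    qed
    then have "b - a = 0"
      unfolding T_def by (metis bop_apply_inject zero_bop.rep_eq ext)
    then show "a = b" by simp
  qed
qed

end

text \<open>By the Riesz representation theorem this describes exactly one operator for every \<open>a\<close>.\<close>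

definition adj :: "'h::chilbert_space bop \<Rightarrow> 'h bop"
  where "adj a = (THE b. \<forall>x y. cinner (bop_apply b x) y = cinner x (bop_apply a y))"

definition ultraweak_topology :: "'h::chilbert_space bop topology"
  where "ultraweak_topology = topology_generated_by
    {{a. (\<Sum>n. cinner (x n) (bop_apply a (y n))) \<in> U} | x y U.
       summable (\<lambda>n::nat. (norm (x n))\<^sup>2) \<and> summable (\<lambda>n. (norm (y n))\<^sup>2) \<and> open U}"


section \<open>Von Neumann algebras\<close>

definition commutant :: "'h::chilbert_space bop set \<Rightarrow> 'h bop set"
  where "commutant S = {b. \<forall>a\<in>S. a * b = b * a}"

text \<open>A von Neumann algebra contains the identity operator, so a von Neumann algebra \<open>N \<subseteq> M\<close> is a
  subalgebra of \<open>M\<close> with the same unit.\<close>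

definition von_neumann_algebra :: "'h::chilbert_space bop set \<Rightarrow> bool"
  where "von_neumann_algebra M \<longleftrightarrow> (\<forall>a\<in>M. adj a \<in> M) \<and> commutant (commutant M) = M"

definition clinear_on :: "'a::complex_vector set \<Rightarrow> ('a \<Rightarrow> 'b::complex_vector) \<Rightarrow> bool"
  where "clinear_on M f \<longleftrightarrow>
    (\<forall>a\<in>M. \<forall>b\<in>M. f (a + b) = f a + f b) \<and> (\<forall>c. \<forall>a\<in>M. f (c *\<^sub>C a) = c *\<^sub>C f a)"

definition star_automorphism :: "'h::chilbert_space bop set \<Rightarrow> ('h bop \<Rightarrow> 'h bop) \<Rightarrow> bool"
  where "star_automorphism M \<Phi> \<longleftrightarrow>
    bij_betw \<Phi> M M \<and> clinear_on M \<Phi> \<and>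
    (\<forall>a\<in>M. \<forall>b\<in>M. \<Phi> (a * b) = \<Phi> a * \<Phi> b) \<and> (\<forall>a\<in>M. \<Phi> (adj a) = adj (\<Phi> a))"

definition unital_schwartz_map :: "'h::chilbert_space bop set \<Rightarrow> ('h bop \<Rightarrow> 'h bop) \<Rightarrow> bool"
  where "unital_schwartz_map M \<Phi> \<longleftrightarrow>
    \<Phi> \<in> M \<rightarrow> M \<and> clinear_on M \<Phi> \<and>
    continuous_map (subtopology ultraweak_topology M) (subtopology ultraweak_topology M) \<Phi> \<and>
    \<Phi> 1 = 1 \<and>
    (\<forall>a\<in>M. 0 \<le> \<Phi> (adj a) * \<Phi> a \<and> \<Phi> (adj a) * \<Phi> a \<le> \<Phi> (adj a * a))"

definition normal_faithful_state :: "'h::chilbert_space bop set \<Rightarrow> ('h bop \<Rightarrow> complex) \<Rightarrow> bool"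
  where "normal_faithful_state M \<phi> \<longleftrightarrow>
    clinear_on M \<phi> \<and> (\<forall>a\<in>M. 0 \<le> a \<longrightarrow> \<phi> a \<in> \<real>\<^sub>\<ge>\<^sub>0) \<and> \<phi> 1 = 1 \<and>
    continuous_map (subtopology ultraweak_topology M) euclidean \<phi> \<and>
    (\<forall>a\<in>M. 0 \<le> a \<and> \<phi> a = 0 \<longrightarrow> a = 0)"

definition state_adjoint ::
    "'h::chilbert_space bop set \<Rightarrow> ('h bop \<Rightarrow> 'h bop) \<Rightarrow> ('h bop \<Rightarrow> complex) \<Rightarrow> ('h bop \<Rightarrow> 'h bop) \<Rightarrow> bool"
  where "state_adjoint M \<Phi> \<phi> \<Psi> \<longleftrightarrow>
    unital_schwartz_map M \<Psi> \<and> (\<forall>a\<in>M. \<forall>b\<in>M. \<phi> (b * \<Phi> a) = \<phi> (\<Psi> b * a))"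

definition quantum_dynamical_system ::
    "'h::chilbert_space bop set \<Rightarrow> ('h bop \<Rightarrow> 'h bop) \<Rightarrow> ('h bop \<Rightarrow> complex) \<Rightarrow> bool"
  where "quantum_dynamical_system M \<Phi> \<phi> \<longleftrightarrow>
    von_neumann_algebra M \<and> unital_schwartz_map M \<Phi> \<and> normal_faithful_state M \<phi> \<and>
    (\<forall>a\<in>M. \<phi> (\<Phi> a) = \<phi> a) \<and> (\<exists>\<Psi>. state_adjoint M \<Phi> \<phi> \<Psi>)"

definition multiplicative_domain ::
    "'h::chilbert_space bop set \<Rightarrow> ('h bop \<Rightarrow> 'h bop) \<Rightarrow> 'h bop set"
  where "multiplicative_domain M \<Psi> =
    {a\<in>M. \<Psi> (adj a * a) = \<Psi> (adj a) * \<Psi> a \<and> \<Psi> (a * adj a) = \<Psi> a * \<Psi> (adj a)}"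

definition dynamics :: "('a \<Rightarrow> 'a) \<Rightarrow> ('a \<Rightarrow> 'a) \<Rightarrow> int \<Rightarrow> 'a \<Rightarrow> 'a"
  where "dynamics \<Phi> \<Phi>s k = (if 0 \<le> k then \<Phi> ^^ nat k else \<Phi>s ^^ nat \<bar>k\<bar>)"

definition D_infinity ::
    "'h::chilbert_space bop set \<Rightarrow> ('h bop \<Rightarrow> 'h bop) \<Rightarrow> ('h bop \<Rightarrow> 'h bop) \<Rightarrow> 'h bop set"
  where "D_infinity M \<Phi> \<Phi>s = (\<Inter>k. multiplicative_domain M (dynamics \<Phi> \<Phi>s k))"

end

theory Submission
  imports Defs
begin

text \<open>
  Since \<open>\<phi>\<close> is faithful and \<open>\<Phi>\<close>-invariant, \<open>\<phi>(\<Phi>(a)\<^sup>* \<Phi>(a)) \<le> \<phi>(a\<^sup>* a)\<close>, with equality exactly when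
  \<open>\<Phi>(a\<^sup>* a) = \<Phi>(a)\<^sup>* \<Phi>(a)\<close>, and this amounts to \<open>\<Phi>\<^sup>\<sharp>(\<Phi>(a)) = a\<close>: in the GNS space of \<open>\<phi>\<close> the map
  \<open>\<Phi>\<close> is a contraction with adjoint \<open>\<Phi>\<^sup>\<sharp>\<close>. Following \<open>a\<close> along its orbit, the multiplicative
  domain of \<open>\<Phi>\<^sup>n\<close> consists of the \<open>a\<close> with \<open>\<Phi>\<^sup>\<sharp>\<Phi>(\<Phi>\<^sup>j(a)) = \<Phi>\<^sup>j(a)\<close> for \<open>j < n\<close>, so \<open>D\<^sub>\<infinity>\<close> is the
  largest subset of \<open>M\<close> invariant under both maps on which they are inverse to each other. On it
  \<open>\<Phi>\<close> is multiplicative by polarising the Schwartz inequality. Being a unital *-algebra cut out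
  of \<open>M\<close> by ultraweakly continuous equations, it equals its bicommutant by von Neumann's density
  theorem, obtained from the amplification of the Hilbert space to square-summable sequences.
\<close>

section \<open>Closed subspaces and square-summability estimates\<close>

lemma subspace_closure:
  fixes S :: "'a::real_normed_vector set"
  assumes "subspace S"
  shows "subspace (closure S)"
proof (rule subspaceI)
  show "0 \<in> closure S"
    using closure_subset subspace_0[OF assms] by blast
  show "x + y \<in> closure S" if xy: "x \<in> closure S" "y \<in> closure S" for x y
  proof -
    obtain f g where "\<forall>n. f n \<in> S" "f \<longlonglongrightarrow> x" "\<forall>n. g n \<in> S" "g \<longlonglongrightarrow> y"
      using xy unfolding closure_sequential by blast
    then have "\<forall>n. f n + g n \<in> S" "(\<lambda>n. f n + g n) \<longlonglongrightarrow> x + y"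
      by (auto intro: tendsto_add subspace_add[OF assms])
    then show ?thesis
      unfolding closure_sequential by (intro exI[of _ "\<lambda>n. f n + g n"]) simp
  qed
  show "r *\<^sub>R x \<in> closure S" if xy: "x \<in> closure S" for r x
  proof -
    obtain f where "\<forall>n. f n \<in> S" "f \<longlonglongrightarrow> x"
      using xy unfolding closure_sequential by blast
    then have "\<forall>n. r *\<^sub>R f n \<in> S" "(\<lambda>n. r *\<^sub>R f n) \<longlonglongrightarrow> r *\<^sub>R x"
      by (auto intro: tendsto_intros subspace_scale[OF assms])
    then show ?thesis
      unfolding closure_sequential by (intro exI[of _ "\<lambda>n. r *\<^sub>R f n"]) simp
  qed
qed

lemma summable_norm_mult:
  fixes x :: "nat \<Rightarrow> 'a::real_normed_vector" and y :: "nat \<Rightarrow> 'b::real_normed_vector"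
  assumes "summable (\<lambda>n. (norm (x n))\<^sup>2)" and "summable (\<lambda>n. (norm (y n))\<^sup>2)"
  shows "summable (\<lambda>n. norm (x n) * norm (y n))"
proof (rule summable_comparison_test'[OF summable_add[OF assms], of 0])
  fix n :: nat
  have "2 * (norm (x n) * norm (y n)) \<le> (norm (x n))\<^sup>2 + (norm (y n))\<^sup>2"
    using sum_squares_bound[of "norm (x n)" "norm (y n)"] by (simp add: mult.assoc)
  moreover have "0 \<le> norm (x n) * norm (y n)"
    by simp
  ultimately show "norm (norm (x n) * norm (y n)) \<le> (norm (x n))\<^sup>2 + (norm (y n))\<^sup>2"
    unfolding real_norm_def by linarith
qed

lemma summable_norm_add_power2:
  fixes x y :: "nat \<Rightarrow> 'a::real_normed_vector"
  assumes "summable (\<lambda>n. (norm (x n))\<^sup>2)" and "summable (\<lambda>n. (norm (y n))\<^sup>2)"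
  shows "summable (\<lambda>n. (norm (x n + y n))\<^sup>2)"
proof (rule summable_comparison_test'[OF summable_mult[OF summable_add[OF assms], of 2], of 0])
  fix n :: nat
  have "(norm (x n + y n))\<^sup>2 \<le> (norm (x n) + norm (y n))\<^sup>2"
    by (intro power_mono norm_triangle_ineq) simp
  also have "\<dots> \<le> 2 * ((norm (x n))\<^sup>2 + (norm (y n))\<^sup>2)"
    using sum_squares_bound[of "norm (x n)" "norm (y n)"]
    by (simp add: power2_sum algebra_simps)
  finally show "norm ((norm (x n + y n))\<^sup>2) \<le> 2 * ((norm (x n))\<^sup>2 + (norm (y n))\<^sup>2)"
    by simp
qed

section \<open>Square-summable sequences\<close>

text \<open>Only the real inner product structure is built on sequences. This suffices for
  projections, and multiplication by \<i> is later recovered as the amplification of the operator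
  \<open>\<i> *\<^sub>C 1\<close>.\<close>

typedef (overloaded) 'a l2 = "{x :: nat \<Rightarrow> 'a::real_inner. summable (\<lambda>n. (norm (x n))\<^sup>2)}"
  morphisms l2_nth L2
  by (rule exI[of _ "\<lambda>_. 0"]) simp

setup_lifting type_definition_l2

lemma summable_l2_nth: "summable (\<lambda>n. (norm (l2_nth x n))\<^sup>2)"
  using l2_nth[of x] by simp

lemma l2_nth_L2 [simp]: "summable (\<lambda>n. (norm (x n))\<^sup>2) \<Longrightarrow> l2_nth (L2 x) = x"
  by (simp add: L2_inverse)

lemma l2_eqI: "(\<And>n. l2_nth x n = l2_nth y n) \<Longrightarrow> x = y"
  by (simp add: l2_nth_inject[symmetric] fun_eq_iff)

lemma summable_inner_l2_nth: "summable (\<lambda>n. l2_nth x n \<bullet> l2_nth y n)"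
  by (rule summable_comparison_test'
      [OF summable_norm_mult[OF summable_l2_nth[of x] summable_l2_nth[of y]], of 0])
    (simp add: Cauchy_Schwarz_ineq2)

instantiation l2 :: (real_inner) real_inner
begin

lift_definition zero_l2 :: "'a l2" is "\<lambda>_. 0"
  by simp

lift_definition plus_l2 :: "'a l2 \<Rightarrow> 'a l2 \<Rightarrow> 'a l2" is "\<lambda>x y n. x n + y n"
  by (rule summable_norm_add_power2)

lift_definition uminus_l2 :: "'a l2 \<Rightarrow> 'a l2" is "\<lambda>x n. - x n"
  by simp

lift_definition minus_l2 :: "'a l2 \<Rightarrow> 'a l2 \<Rightarrow> 'a l2" is "\<lambda>x y n. x n - y n"
  subgoal for x y using summable_norm_add_power2[of x "\<lambda>n. - y n"] by simp
  done

lift_definition scaleR_l2 :: "real \<Rightarrow> 'a l2 \<Rightarrow> 'a l2" is "\<lambda>r x n. r *\<^sub>R x n"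
  by (simp add: power_mult_distrib summable_mult)

definition inner_l2 :: "'a l2 \<Rightarrow> 'a l2 \<Rightarrow> real"
  where "inner_l2 x y = (\<Sum>n. l2_nth x n \<bullet> l2_nth y n)"

definition norm_l2 :: "'a l2 \<Rightarrow> real"
  where "norm_l2 x = sqrt (x \<bullet> x)"

definition dist_l2 :: "'a l2 \<Rightarrow> 'a l2 \<Rightarrow> real"
  where "dist_l2 x y = norm (x - y)"

definition sgn_l2 :: "'a l2 \<Rightarrow> 'a l2"
  where "sgn_l2 x = inverse (norm x) *\<^sub>R x"

definition uniformity_l2 :: "('a l2 \<times> 'a l2) filter"
  where "uniformity_l2 = (INF e\<in>{0<..}. principal {(x, y). dist x y < e})"

definition open_l2 :: "'a l2 set \<Rightarrow> bool"
  where "open_l2 U \<longleftrightarrow> (\<forall>x\<in>U. eventually (\<lambda>(x', y). x' = x \<longrightarrow> y \<in> U) uniformity)"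

instance
proof
  fix x y z :: "'a l2" and r s :: real and U :: "'a l2 set"
  show "x + y + z = x + (y + z)" by transfer (simp add: add.assoc)
  show "x + y = y + x" by transfer (simp add: add.commute)
  show "0 + x = x" by transfer simp
  show "- x + x = 0" by transfer simp
  show "x - y = x + - y" by transfer simp
  show "r *\<^sub>R (x + y) = r *\<^sub>R x + r *\<^sub>R y" by transfer (simp add: scaleR_add_right)
  show "(r + s) *\<^sub>R x = r *\<^sub>R x + s *\<^sub>R x" by transfer (simp add: scaleR_add_left)
  show "r *\<^sub>R s *\<^sub>R x = (r * s) *\<^sub>R x" by transfer simp
  show "1 *\<^sub>R x = x" by transfer simp
  show "dist x y = norm (x - y)" by (rule dist_l2_def)
  show "sgn x = inverse (norm x) *\<^sub>R x" by (rule sgn_l2_def)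
  show "uniformity = (INF e\<in>{0<..}. principal {(x, y :: 'a l2). dist x y < e})"
    by (rule uniformity_l2_def)
  show "open U \<longleftrightarrow> (\<forall>x\<in>U. eventually (\<lambda>(x', y). x' = x \<longrightarrow> y \<in> U) uniformity)"
    by (rule open_l2_def)
  show "x \<bullet> y = y \<bullet> x" by (simp add: inner_l2_def inner_commute)
  show "(x + y) \<bullet> z = x \<bullet> z + y \<bullet> z"
    by (simp add: inner_l2_def plus_l2.rep_eq inner_add_left suminf_add summable_inner_l2_nth)
  show "(r *\<^sub>R x) \<bullet> y = r * (x \<bullet> y)"
    by (simp add: inner_l2_def scaleR_l2.rep_eq suminf_mult summable_inner_l2_nth)
  show "0 \<le> x \<bullet> x"
    by (simp add: inner_l2_def suminf_nonneg summable_inner_l2_nth)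
  show "(x \<bullet> x = 0) = (x = 0)"
    by (simp add: inner_l2_def suminf_eq_zero_iff summable_inner_l2_nth l2_nth_inject[symmetric]
        zero_l2.rep_eq fun_eq_iff)
  show "norm x = sqrt (x \<bullet> x)" by (rule norm_l2_def)
qed

end

lemma l2_inner_sums: "(\<lambda>n. l2_nth x n \<bullet> l2_nth y n) sums (x \<bullet> y)"
  unfolding inner_l2_def by (rule summable_sums[OF summable_inner_l2_nth])

lemma norm_l2_power2: "(norm x)\<^sup>2 = (\<Sum>n. (norm (l2_nth x n))\<^sup>2)"
  by (simp add: power2_norm_eq_inner inner_l2_def)

lemma sum_norm_l2_nth_le: "(\<Sum>n<N. (norm (l2_nth x n))\<^sup>2) \<le> (norm x)\<^sup>2"
  unfolding norm_l2_power2 by (rule sum_le_suminf) (simp_all add: summable_l2_nth)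

lemma norm_l2_nth_le: "norm (l2_nth x n) \<le> norm x"
proof -
  have "(norm (l2_nth x n))\<^sup>2 \<le> (\<Sum>k<Suc n. (norm (l2_nth x k))\<^sup>2)"
    by (simp add: sum_nonneg)
  also have "\<dots> \<le> (norm x)\<^sup>2"
    by (rule sum_norm_l2_nth_le)
  finally show ?thesis
    by (rule power2_le_imp_le) simp
qed

lemma bounded_linear_l2_nth: "bounded_linear (\<lambda>x. l2_nth x n)"
  by (rule bounded_linear_intro[of _ 1])
    (simp_all add: plus_l2.rep_eq scaleR_l2.rep_eq norm_l2_nth_le)

text \<open>Bounds on partial sums survive pointwise limits and coordinatewise estimates, so this
  criterion serves both the completeness of \<open>l2\<close> and the boundedness of amplified
  operators.\<close>

lemma norm_L2_le:
  assumes "\<And>N. (\<Sum>n<N. (norm (z n))\<^sup>2) \<le> e\<^sup>2" and "0 \<le> e"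
  shows "summable (\<lambda>n. (norm (z n))\<^sup>2)" and "norm (L2 z) \<le> e"
proof -
  show s: "summable (\<lambda>n. (norm (z n))\<^sup>2)"
    by (rule summableI_nonneg_bounded[OF _ assms(1)]) simp
  then have "(norm (L2 z))\<^sup>2 \<le> e\<^sup>2"
    unfolding norm_l2_power2 using suminf_le_const[OF s assms(1)] by simp
  then show "norm (L2 z) \<le> e"
    using assms(2) by (rule power2_le_imp_le)
qed

text \<open>Coordinates of a Cauchy sequence converge because coordinate maps are contractive. The
  bounds on finite partial sums of \<open>X k - X l\<close> then pass to the limit in
  \<open>l\<close>, which controls \<open>X k - z\<close> uniformly.\<close>

instance l2 :: ("{real_inner, complete_space}") complete_space
proof
  fix X :: "nat \<Rightarrow> 'a l2"
  assume X: "Cauchy X"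
  define z where "z n = lim (\<lambda>k. l2_nth (X k) n)" for n
  have nth: "(\<lambda>k. l2_nth (X k) n) \<longlonglongrightarrow> z n" for n
    unfolding z_def using bounded_linear.Cauchy[OF bounded_linear_l2_nth X]
    by (simp add: Cauchy_convergent_iff convergent_LIMSEQ_iff)
  have tail: "\<exists>K. \<forall>k\<ge>K. summable (\<lambda>n. (norm (l2_nth (X k) n - z n))\<^sup>2) \<and>
      norm (L2 (\<lambda>n. l2_nth (X k) n - z n)) \<le> e" if e: "0 < e" for e
  proof -
    obtain K where K: "norm (X k - X l) < e" if "k \<ge> K" "l \<ge> K" for k l
      using X e unfolding Cauchy_def dist_norm by blast
    have "(\<Sum>n<N. (norm (l2_nth (X k) n - z n))\<^sup>2) \<le> e\<^sup>2" if k: "k \<ge> K" for k N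
    proof (rule tendsto_upperbound)
      show "(\<lambda>l. \<Sum>n<N. (norm (l2_nth (X k) n - l2_nth (X l) n))\<^sup>2)
          \<longlonglongrightarrow> (\<Sum>n<N. (norm (l2_nth (X k) n - z n))\<^sup>2)"
        by (intro tendsto_intros nth)
      show "\<forall>\<^sub>F l in sequentially. (\<Sum>n<N. (norm (l2_nth (X k) n - l2_nth (X l) n))\<^sup>2) \<le> e\<^sup>2"
        using eventually_ge_at_top[of K]
      proof eventually_elim
        case (elim l)
        have "(\<Sum>n<N. (norm (l2_nth (X k) n - l2_nth (X l) n))\<^sup>2) \<le> (norm (X k - X l))\<^sup>2"
          using sum_norm_l2_nth_le[of "X k - X l"] by (simp add: minus_l2.rep_eq)
        also have "\<dots> \<le> e\<^sup>2"
          using K[OF k elim] by (intro power_mono) simp_all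
        finally show ?case .
      qed
    qed simp
    then show ?thesis
      using e by (intro exI[of _ K] allI impI conjI norm_L2_le) (assumption | simp)+
  qed
  obtain K where "summable (\<lambda>n. (norm (l2_nth (X K) n - z n))\<^sup>2)"
    using tail[of 1] by auto
  \<comment> \<open>Adding \<open>- X K\<close> to the difference \<open>X K - z\<close> leaves
    \<open>- z\<close>, so the coordinatewise limit is itself square-summable.\<close>
  from summable_norm_add_power2[OF summable_l2_nth[of "- X K"] this]
  have z: "summable (\<lambda>n. (norm (z n))\<^sup>2)"
    by (simp add: uminus_l2.rep_eq)
  have diff: "L2 (\<lambda>n. l2_nth (X k) n - z n) = X k - L2 z"
    if "summable (\<lambda>n. (norm (l2_nth (X k) n - z n))\<^sup>2)" for k
    using that z by (intro l2_eqI) (simp add: minus_l2.rep_eq)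
  have "X \<longlonglongrightarrow> L2 z"
  proof (rule LIMSEQ_I)
    fix e :: real
    assume "0 < e"
    then obtain K where K: "summable (\<lambda>n. (norm (l2_nth (X k) n - z n))\<^sup>2)"
        "norm (L2 (\<lambda>n. l2_nth (X k) n - z n)) \<le> e / 2" if "k \<ge> K" for k
      using tail[of "e / 2"] by auto
    have "norm (X k - L2 z) < e" if "k \<ge> K" for k
      using K[OF that] diff[of k] \<open>0 < e\<close> by simp
    then show "\<exists>K. \<forall>k\<ge>K. norm (X k - L2 z) < e"
      by blast
  qed
  then show "convergent X"
    by (rule convergentI)
qed

lift_definition l2_single :: "nat \<Rightarrow> 'a::real_inner \<Rightarrow> 'a l2"
  is "\<lambda>k v n. if n = k then v else 0"
  subgoal for k v by (rule summable_finite[of "{k}"]) auto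
  done

text \<open>The squared norm of the remainder is a tail of the convergent series of squared norms.
  This expansion later expresses an operator on sequences through its matrix entries.\<close>

lemma l2_sums_single: "(\<lambda>n. l2_single n (l2_nth x n)) sums x"
proof -
  have nth: "l2_nth (x - (\<Sum>k<N. l2_single k (l2_nth x k))) n = (if n < N then 0 else l2_nth x n)" for N n
    by (induction N) (auto simp: minus_l2.rep_eq plus_l2.rep_eq zero_l2.rep_eq l2_single.rep_eq less_Suc_eq)
  have "(norm (x - (\<Sum>k<N. l2_single k (l2_nth x k))))\<^sup>2 =
      (\<Sum>n. (norm (l2_nth x n))\<^sup>2) - (\<Sum>n<N. (norm (l2_nth x n))\<^sup>2)" for N
  proof -
    have "(norm (x - (\<Sum>k<N. l2_single k (l2_nth x k))))\<^sup>2 =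
        (\<Sum>n. (norm (l2_nth x n))\<^sup>2 - (if n \<in> {..<N} then (norm (l2_nth x n))\<^sup>2 else 0))"
      unfolding norm_l2_power2 nth by (intro suminf_cong) simp
    also have "\<dots> = (\<Sum>n. (norm (l2_nth x n))\<^sup>2) -
        (\<Sum>n. if n \<in> {..<N} then (norm (l2_nth x n))\<^sup>2 else 0)"
      by (rule suminf_diff[symmetric]) (auto intro: summable_l2_nth)
    also have "(\<Sum>n. if n \<in> {..<N} then (norm (l2_nth x n))\<^sup>2 else 0) = (\<Sum>n<N. (norm (l2_nth x n))\<^sup>2)"
      by (subst suminf_finite[of "{..<N}"]) auto
    finally show ?thesis .
  qed
  moreover have "(\<lambda>N. (\<Sum>n. (norm (l2_nth x n))\<^sup>2) - (\<Sum>n<N. (norm (l2_nth x n))\<^sup>2)) \<longlonglongrightarrow> 0"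
    using tendsto_diff[OF tendsto_const[of "\<Sum>n. (norm (l2_nth x n))\<^sup>2"]
        summable_LIMSEQ[OF summable_l2_nth[of x]]] by simp
  ultimately have "(\<lambda>N. (norm (x - (\<Sum>k<N. l2_single k (l2_nth x k))))\<^sup>2) \<longlonglongrightarrow> 0"
    by simp
  then have "(\<lambda>N. sqrt ((norm (x - (\<Sum>k<N. l2_single k (l2_nth x k))))\<^sup>2)) \<longlonglongrightarrow> sqrt 0"
    by (rule tendsto_real_sqrt)
  then have "(\<lambda>N. x - (\<Sum>k<N. l2_single k (l2_nth x k))) \<longlonglongrightarrow> 0"
    by (simp add: tendsto_norm_zero_iff)
  from tendsto_diff[OF tendsto_const[of x] this] show ?thesis
    by (simp add: sums_def)
qed

section \<open>Orthogonal projections and adjoints\<close>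

text \<open>A minimising sequence is Cauchy by the parallelogram law, and its limit stays in
  \<open>K\<close> because \<open>K\<close> is closed.\<close>

lemma nearest_point_subspace:
  fixes K :: "'a::{real_inner, complete_space} set"
  assumes K: "subspace K" "closed K"
  shows "\<exists>p\<in>K. \<forall>q\<in>K. norm (x - p) \<le> norm (x - q)"
proof -
  define \<delta> where "\<delta> = (INF q\<in>K. (norm (x - q))\<^sup>2)"
  have ne: "K \<noteq> {}"
    using subspace_0[OF K(1)] by blast
  have bdd: "bdd_below ((\<lambda>q. (norm (x - q))\<^sup>2) ` K)"
    by (rule bdd_belowI[of _ 0]) auto
  have lb: "\<delta> \<le> (norm (x - q))\<^sup>2" if "q \<in> K" for q
    unfolding \<delta>_def using that bdd by (rule cINF_lower[rotated])
  have "\<exists>q\<in>K. (norm (x - q))\<^sup>2 < \<delta> + inverse (real (Suc n))" for n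
    using cINF_less_iff[OF ne bdd, of "\<delta> + inverse (real (Suc n))"] unfolding \<delta>_def by simp
  then obtain q where q: "q n \<in> K" "(norm (x - q n))\<^sup>2 < \<delta> + inverse (real (Suc n))" for n
    by metis
  \<comment> \<open>The midpoint of \<open>q m\<close> and \<open>q n\<close> lies in
    \<open>K\<close>, so its squared distance to \<open>x\<close> is at least \<delta>; the
    parallelogram identity turns this into a bound on \<open>q m - q n\<close>.\<close>
  have par: "(norm (q m - q n))\<^sup>2 \<le> 2 * (inverse (real (Suc m)) + inverse (real (Suc n)))" for m n
  proof -
    have "(1 / 2) *\<^sub>R (q m + q n) \<in> K"
      using q(1) K(1) by (simp add: subspace_add subspace_scale)
    from lb[OF this] have "4 * \<delta> \<le> (norm ((x - q m) + (x - q n)))\<^sup>2"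
      by (simp add: power2_norm_eq_inner algebra_simps inner_commute)
    moreover have "(norm (q m - q n))\<^sup>2 + (norm ((x - q m) + (x - q n)))\<^sup>2 =
        2 * (norm (x - q m))\<^sup>2 + 2 * (norm (x - q n))\<^sup>2"
      by (simp add: power2_norm_eq_inner algebra_simps inner_commute)
    ultimately show ?thesis
      using q(2)[of m] q(2)[of n] by (simp add: distrib_left)
  qed
  have "Cauchy q"
  proof (rule CauchyI)
    fix e :: real
    assume e: "0 < e"
    then obtain N where N: "inverse (real (Suc N)) < e\<^sup>2 / 4"
      using reals_Archimedean[of "e\<^sup>2 / 4"] by auto
    have "norm (q m - q n) < e" if "m \<ge> N" "n \<ge> N" for m n
    proof -
      have "inverse (real (Suc m)) \<le> inverse (real (Suc N))" "inverse (real (Suc n)) \<le> inverse (real (Suc N))"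
        using that by (simp_all add: le_imp_inverse_le)
      then have "(norm (q m - q n))\<^sup>2 < e\<^sup>2"
        using par[of m n] N unfolding distrib_left by linarith
      then show ?thesis
        using e by (auto intro: power_less_imp_less_base)
    qed
    then show "\<exists>N. \<forall>m\<ge>N. \<forall>n\<ge>N. norm (q m - q n) < e"
      by blast
  qed
  then obtain p where p: "q \<longlonglongrightarrow> p"
    using Cauchy_convergent_iff convergent_def by blast
  have "p \<in> K"
    using K(2) q(1) p by (rule closed_sequentially)
  moreover have "(norm (x - p))\<^sup>2 \<le> \<delta>"
  proof (rule LIMSEQ_le)
    show "(\<lambda>n. (norm (x - q n))\<^sup>2) \<longlonglongrightarrow> (norm (x - p))\<^sup>2"
      by (intro tendsto_intros p)
    show "(\<lambda>n. \<delta> + inverse (real (Suc n))) \<longlonglongrightarrow> \<delta>"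
      using tendsto_add[OF tendsto_const LIMSEQ_inverse_real_of_nat] by simp
    show "\<exists>N. \<forall>n\<ge>N. (norm (x - q n))\<^sup>2 \<le> \<delta> + inverse (real (Suc n))"
      using q(2) less_imp_le by blast
  qed
  ultimately show ?thesis
    using lb by (meson norm_ge_zero order_trans power2_le_imp_le)
qed

text \<open>Moving the nearest point in the direction of \<open>q\<close> cannot decrease the
  distance to \<open>x\<close>, which forces the first-order term to vanish.\<close>

lemma orthogonal_projection_exists:
  fixes K :: "'a::{real_inner, complete_space} set"
  assumes K: "subspace K" "closed K"
  shows "\<exists>p\<in>K. \<forall>q\<in>K. (x - p) \<bullet> q = 0"
proof -
  obtain p where p: "p \<in> K" "\<And>q. q \<in> K \<Longrightarrow> norm (x - p) \<le> norm (x - q)"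
    using nearest_point_subspace[OF K] by blast
  have "(x - p) \<bullet> q = 0" if q: "q \<in> K" for q
  proof (cases "q = 0")
    case False
    \<comment> \<open>This coefficient minimises the quadratic function
      \<open>(norm ((x - p) - t *\<^sub>R q))\<^sup>2\<close> of \<open>t\<close>.\<close>
    define t where "t = ((x - p) \<bullet> q) / (q \<bullet> q)"
    have "p + t *\<^sub>R q \<in> K"
      using p(1) q K(1) by (simp add: subspace_add subspace_scale)
    from p(2)[OF this] have "(norm (x - p))\<^sup>2 \<le> (norm ((x - p) - t *\<^sub>R q))\<^sup>2"
      by (simp add: power_mono algebra_simps)
    also have "\<dots> = (norm (x - p))\<^sup>2 - 2 * t * ((x - p) \<bullet> q) + t * (t * (q \<bullet> q))"
      by (simp add: power2_norm_eq_inner algebra_simps inner_commute)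
    also have "t * (q \<bullet> q) = (x - p) \<bullet> q"
      using False by (simp add: t_def)
    finally have "t * ((x - p) \<bullet> q) \<le> 0"
      by simp
    then have "((x - p) \<bullet> q)\<^sup>2 / (q \<bullet> q) \<le> 0"
      by (simp add: t_def power2_eq_square)
    moreover have "0 < q \<bullet> q"
      using False by simp
    ultimately show ?thesis
      by (simp add: divide_le_0_iff)
  qed simp
  then show ?thesis
    using p(1) by blast
qed

definition orth_proj :: "'a::real_inner set \<Rightarrow> 'a \<Rightarrow> 'a"
  where "orth_proj K x = (SOME p. p \<in> K \<and> (\<forall>q\<in>K. (x - p) \<bullet> q = 0))"

context
  fixes K :: "'a::{real_inner, complete_space} set"
  assumes K: "subspace K" "closed K"
begin

lemma orth_proj_in: "orth_proj K x \<in> K"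
  and orth_proj_orthogonal: "q \<in> K \<Longrightarrow> (x - orth_proj K x) \<bullet> q = 0"
  using someI_ex[of "\<lambda>p. p \<in> K \<and> (\<forall>q\<in>K. (x - p) \<bullet> q = 0)"] orthogonal_projection_exists[OF K, of x]
  unfolding orth_proj_def[symmetric] by blast+

lemma orth_proj_eqI:
  assumes "p \<in> K" and "\<And>q. q \<in> K \<Longrightarrow> (x - p) \<bullet> q = 0"
  shows "orth_proj K x = p"
proof -
  have d: "orth_proj K x - p \<in> K"
    using K(1) orth_proj_in assms(1) by (rule subspace_diff)
  have "(orth_proj K x - p) \<bullet> (orth_proj K x - p) =
      (x - p) \<bullet> (orth_proj K x - p) - (x - orth_proj K x) \<bullet> (orth_proj K x - p)"
    by (simp add: inner_diff_left)
  also have "\<dots> = 0"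
    using assms(2)[OF d] orth_proj_orthogonal[OF d, of x] by simp
  finally show ?thesis
    by simp
qed

lemma orth_proj_id: "x \<in> K \<Longrightarrow> orth_proj K x = x"
  by (rule orth_proj_eqI) simp_all

lemma bounded_linear_orth_proj: "bounded_linear (orth_proj K)"
proof (rule bounded_linear_intro[of _ 1])
  fix x y :: 'a and r :: real
  show "orth_proj K (x + y) = orth_proj K x + orth_proj K y"
    by (rule orth_proj_eqI)
      (simp_all add: K(1) orth_proj_in subspace_add add_diff_add inner_add_left orth_proj_orthogonal)
  show "orth_proj K (r *\<^sub>R x) = r *\<^sub>R orth_proj K x"
    by (rule orth_proj_eqI)
      (simp_all add: K(1) orth_proj_in subspace_scale scaleR_diff_right[symmetric] orth_proj_orthogonal)
  have "(norm (orth_proj K x))\<^sup>2 = x \<bullet> orth_proj K x"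
    using orth_proj_orthogonal[OF orth_proj_in, of x x]
    by (simp add: power2_norm_eq_inner inner_diff_left)
  also have "\<dots> \<le> norm x * norm (orth_proj K x)"
    by (rule norm_cauchy_schwarz)
  finally have "norm (orth_proj K x) * norm (orth_proj K x) \<le> norm x * norm (orth_proj K x)"
    by (simp add: power2_eq_square)
  then show "norm (orth_proj K x) \<le> norm x * 1"
    by (metis mult_le_cancel_right mult_1_right norm_ge_zero order_less_le)
qed

text \<open>\<open>S\<close> is the adjoint of \<open>T\<close>. Invariance of \<open>K\<close>
  under \<open>S\<close> makes the orthogonal complement of \<open>K\<close> invariant under
  \<open>T\<close>, so \<open>T\<close> respects the orthogonal decomposition.\<close>

lemma orth_proj_commute:
  assumes T: "\<And>q. q \<in> K \<Longrightarrow> T q \<in> K" "\<And>x y. T (x - y) = T x - T y"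
    and S: "\<And>q. q \<in> K \<Longrightarrow> S q \<in> K" "\<And>x y. T x \<bullet> y = x \<bullet> S y"
  shows "orth_proj K (T x) = T (orth_proj K x)"
proof (rule orth_proj_eqI)
  show "T (orth_proj K x) \<in> K"
    by (rule T(1)[OF orth_proj_in])
  show "(T x - T (orth_proj K x)) \<bullet> q = 0" if "q \<in> K" for q
    using orth_proj_orthogonal[OF S(1)[OF that], of x] by (simp add: T(2)[symmetric] S(2))
qed

end

text \<open>A nonzero functional has a kernel of codimension one; a vector \<open>w\<close>
  orthogonal to the kernel, suitably rescaled, represents it.\<close>

lemma riesz_representation:
  fixes f :: "'a::{real_inner, complete_space} \<Rightarrow> real"
  assumes f: "bounded_linear f"
  shows "\<exists>z. \<forall>x. f x = z \<bullet> x"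
proof (cases "\<forall>x. f x = 0")
  case True
  then show ?thesis
    by (intro exI[of _ 0]) simp
next
  case False
  then obtain u where u: "f u \<noteq> 0"
    by blast
  interpret f: bounded_linear f by fact
  define K where "K = {x. f x = 0}"
  have K: "subspace K" "closed K"
    unfolding K_def
    by (auto simp: subspace_def f.add f.scaleR intro!: closed_Collect_eq f.continuous_on continuous_on_id continuous_on_const)
  define w where "w = u - orth_proj K u"
  have fw: "f w = f u"
    using orth_proj_in[OF K, of u] by (simp add: w_def f.diff K_def)
  then have w0: "w \<noteq> 0"
    using u f.zero by force
  have "f x = ((f w / (w \<bullet> w)) *\<^sub>R w) \<bullet> x" for x
  proof -
    \<comment> \<open>Subtracting this multiple of \<open>w\<close> cancels the value of
      \<open>f\<close>; orthogonality to \<open>w\<close> then determines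
      \<open>f x\<close>.\<close>
    have "x - (f x / f w) *\<^sub>R w \<in> K"
      using fw u by (simp add: K_def f.diff f.scaleR)
    from orth_proj_orthogonal[OF K this, of u] have "w \<bullet> x = f x / f w * (w \<bullet> w)"
      by (simp add: w_def[symmetric] inner_diff_right)
    then show ?thesis
      using fw u w0 by simp
  qed
  then show ?thesis
    by blast
qed

section \<open>The algebra of bounded operators\<close>

lemma bop_eqI: "(\<And>x. bop_apply a x = bop_apply b x) \<Longrightarrow> a = b"
  by (simp add: bop_apply_inject[symmetric] fun_eq_iff)

lemma bounded_linear_bop_apply: "bounded_linear (bop_apply a)"
  using bop_apply[of a] by simp

lemma bop_apply_scaleC: "bop_apply a (c *\<^sub>C x) = c *\<^sub>C bop_apply a x"
  using bop_apply[of a] by simp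

lemmas bop_apply_add = bounded_linear.linear[OF bounded_linear_bop_apply, THEN linear_add]
  and bop_apply_zero = bounded_linear.linear[OF bounded_linear_bop_apply, THEN linear_0]
  and bop_apply_scaleR = bounded_linear.linear[OF bounded_linear_bop_apply, THEN linear_scale]

lemmas bop_rep_eqs = zero_bop.rep_eq one_bop.rep_eq plus_bop.rep_eq minus_bop.rep_eq
  uminus_bop.rep_eq times_bop.rep_eq scaleC_bop.rep_eq

lemma bop_apply_scaleR_op: "bop_apply (r *\<^sub>R a) x = r *\<^sub>R bop_apply a x"
  using scaleC_bop.rep_eq[of "complex_of_real r" a] by (simp add: scaleC_of_real)

lemma scaleC_minus_one: "(- 1) *\<^sub>C x = - (x :: 'a::complex_vector)"
  using scaleC_of_real[of "- 1" x] by simp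

lemma bop_mult_scaleC_left: "(c *\<^sub>C a) * b = c *\<^sub>C (a * b)" for a b :: "'h::chilbert_space bop"
  by (rule bop_eqI) (simp add: bop_rep_eqs)

lemma bop_mult_scaleC_right: "a * (c *\<^sub>C b) = c *\<^sub>C (a * b)" for a b :: "'h::chilbert_space bop"
  by (rule bop_eqI) (simp add: bop_rep_eqs bop_apply_scaleC)

text \<open>The imaginary part of a number is minus the real part of \<i> times it. Real Hilbert
  space results thereby apply to the complex inner product.\<close>

lemma cinner_conv_inner: "cinner x y = Complex (x \<bullet> y) (- (x \<bullet> (\<i> *\<^sub>C y)))"
  using cinner_scaleC_right[of x \<i> y] by (simp add: complex_eq_iff Re_cinner[symmetric])

lemma cinner_eqI:
  assumes "\<And>z. cinner x z = cinner y z"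
  shows "x = y"
  using assms by (metis Re_cinner vector_eq_rdot)

text \<open>The real Riesz theorem gives a real adjoint \<open>T\<close>. Complex linearity of
  \<open>a\<close> upgrades its defining equation to the complex inner product, and this in turn
  makes \<open>T\<close> complex linear.\<close>

lemma adj_exists: "\<exists>b. \<forall>x y. cinner (bop_apply b x) y = cinner x (bop_apply a y)"
  for a :: "'h::chilbert_space bop"
proof -
  have "\<exists>z. \<forall>y. x \<bullet> bop_apply a y = z \<bullet> y" for x
    by (intro riesz_representation bounded_linear_intros bounded_linear_bop_apply)
  then obtain T where T: "x \<bullet> bop_apply a y = T x \<bullet> y" for x y
    by metis
  have cT: "cinner (T x) y = cinner x (bop_apply a y)" for x y
    by (simp add: cinner_conv_inner T[symmetric] bop_apply_scaleC)
  have scale: "T (c *\<^sub>C x) = c *\<^sub>C T x" for c x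
    by (rule cinner_eqI) (simp add: cT cinner_scaleC_left)
  obtain C where C: "0 \<le> C" "norm (bop_apply a x) \<le> norm x * C" for x
    using bounded_linear.nonneg_bounded[OF bounded_linear_bop_apply] by blast
  have "bounded_linear T"
  proof (rule bounded_linear_intro)
    fix x y and r :: real
    show "T (x + y) = T x + T y"
      by (rule cinner_eqI) (simp add: cT cinner_add_left)
    show "T (r *\<^sub>R x) = r *\<^sub>R T x"
      using scale[of "complex_of_real r"] by (simp add: scaleC_of_real)
    have "norm (T x) * norm (T x) = x \<bullet> bop_apply a (T x)"
      by (simp add: T norm_eq_sqrt_inner)
    also have "\<dots> \<le> norm x * norm (bop_apply a (T x))"
      by (rule norm_cauchy_schwarz)
    also have "\<dots> \<le> norm x * (norm (T x) * C)"
      by (intro mult_left_mono C) simp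
    finally have "norm (T x) * norm (T x) \<le> (norm x * C) * norm (T x)"
      by (simp add: mult_ac)
    then show "norm (T x) \<le> norm x * C"
      using C(1) by (metis mult_le_cancel_right mult_nonneg_nonneg norm_ge_zero order_less_le)
  qed
  then have "bop_apply (Bop T) = T"
    using scale by (simp add: Bop_inverse)
  then show ?thesis
    using cT by metis
qed

lemma adj_eqI:
  assumes "\<And>x y. cinner (bop_apply b x) y = cinner x (bop_apply a y)"
  shows "adj a = b"
  unfolding adj_def
proof (rule the_equality)
  show "c = b" if "\<forall>x y. cinner (bop_apply c x) y = cinner x (bop_apply a y)" for c
    using that assms by - (rule bop_eqI, rule cinner_eqI, simp)
  show "\<forall>x y. cinner (bop_apply b x) y = cinner x (bop_apply a y)"
    using assms by simp
qed

lemma cinner_adj_left: "cinner (bop_apply (adj a) x) y = cinner x (bop_apply a y)"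
proof -
  obtain b where b: "cinner (bop_apply b x) y = cinner x (bop_apply a y)" for x y
    using adj_exists[of a] by blast
  then show ?thesis
    using adj_eqI[of b a] by simp
qed

lemma cinner_adj_right: "cinner x (bop_apply (adj a) y) = cinner (bop_apply a x) y"
  by (metis cinner_adj_left cinner_commute)

lemma adj_adj [simp]: "adj (adj a) = a"
  by (rule adj_eqI) (simp add: cinner_adj_right)

lemma adj_one [simp]: "adj 1 = 1"
  by (rule adj_eqI) (simp add: bop_rep_eqs)

lemma adj_add: "adj (a + b) = adj a + adj b"
  by (rule adj_eqI) (simp add: bop_rep_eqs cinner_add_left cinner_add_right cinner_adj_left)

lemma adj_scaleC: "adj (c *\<^sub>C a) = cnj c *\<^sub>C adj a"
  by (rule adj_eqI) (simp add: bop_rep_eqs cinner_scaleC_left cinner_scaleC_right cinner_adj_left)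

lemma adj_mult: "adj (a * b) = adj b * adj a"
  by (rule adj_eqI) (simp add: bop_rep_eqs cinner_adj_left)

text \<open>The order compares quadratic forms, so equal forms give both inequalities; complex
  polarisation is already contained in the antisymmetry of the order.\<close>

lemma bop_eq_quadratic_formI:
  fixes a b :: "'h::chilbert_space bop"
  assumes "\<And>x. cinner x (bop_apply a x) = cinner x (bop_apply b x)"
  shows "a = b"
  by (rule order_antisym) (simp_all add: less_eq_bop_def bop_rep_eqs cinner_diff_right assms)

lemma cinner_self_nonneg: "cinner x x \<in> \<real>\<^sub>\<ge>\<^sub>0"
proof -
  have "Im (cinner x x) = 0"
    by (metis cinner_commute complex_cnj_cancel_iff complex_In_mult_cnj_zero Reals_cnj_iff complex_is_Real_iff)
  then show ?thesis
    by (simp add: complex_nonneg_Reals_iff Re_cinner)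
qed

lemma adj_mult_self_nonneg: "0 \<le> adj a * a" for a :: "'h::chilbert_space bop"
  by (simp add: less_eq_bop_def bop_rep_eqs cinner_adj_right cinner_self_nonneg)

lemma adj_mult_self_eq_0D:
  fixes a :: "'h::chilbert_space bop"
  assumes "adj a * a = 0"
  shows "a = 0"
proof (rule bop_eqI)
  fix x
  have "cinner (bop_apply a x) (bop_apply a x) = cinner x (bop_apply (adj a * a) x)"
    by (simp add: bop_rep_eqs cinner_adj_right)
  also have "\<dots> = 0"
    by (simp add: assms bop_rep_eqs)
  finally show "bop_apply a x = bop_apply 0 x"
    using Re_cinner[of "bop_apply a x" "bop_apply a x"] by (simp add: bop_rep_eqs)
qed

section \<open>Commutants and the ultraweak topology\<close>

lemma commutant_antimono: "S \<subseteq> T \<Longrightarrow> commutant T \<subseteq> commutant S"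
  by (auto simp: commutant_def)

lemma subset_double_commutant: "S \<subseteq> commutant (commutant S)"
  by (auto simp: commutant_def)

definition unital_star_subalgebra :: "'h::chilbert_space bop set \<Rightarrow> bool"
  where "unital_star_subalgebra A \<longleftrightarrow> 1 \<in> A \<and> (\<forall>a\<in>A. \<forall>b\<in>A. a + b \<in> A \<and> a * b \<in> A) \<and>
    (\<forall>c. \<forall>a\<in>A. c *\<^sub>C a \<in> A) \<and> (\<forall>a\<in>A. adj a \<in> A)"

lemma unital_star_subalgebraD:
  assumes "unital_star_subalgebra A"
  shows "1 \<in> A"
    and "a \<in> A \<Longrightarrow> b \<in> A \<Longrightarrow> a + b \<in> A"
    and "a \<in> A \<Longrightarrow> b \<in> A \<Longrightarrow> a * b \<in> A"
    and "a \<in> A \<Longrightarrow> c *\<^sub>C a \<in> A"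
    and "a \<in> A \<Longrightarrow> adj a \<in> A"
    and "a \<in> A \<Longrightarrow> b \<in> A \<Longrightarrow> a - b \<in> A"
proof -
  show diff: "a - b \<in> A" if "a \<in> A" "b \<in> A" for a b
  proof -
    have "a + (- 1) *\<^sub>C b \<in> A"
      using assms that unfolding unital_star_subalgebra_def by blast
    then show ?thesis
      by (simp add: scaleC_minus_one)
  qed
qed (use assms in \<open>simp_all add: unital_star_subalgebra_def\<close>)

text \<open>Equality with the bicommutant describes \<open>M\<close> by commutation relations, which
  the algebraic operations preserve.\<close>

lemma von_neumann_algebra_imp_unital_star_subalgebra:
  fixes M :: "'h::chilbert_space bop set"
  assumes "von_neumann_algebra M"
  shows "unital_star_subalgebra M"
proof -
  have "a \<in> M \<longleftrightarrow> (\<forall>b\<in>commutant M. b * a = a * b)" for a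
  proof -
    have "a \<in> M \<longleftrightarrow> a \<in> commutant (commutant M)"
      using assms by (simp add: von_neumann_algebra_def)
    also have "\<dots> \<longleftrightarrow> (\<forall>b\<in>commutant M. b * a = a * b)"
      by (simp add: commutant_def[of "commutant M"])
    finally show ?thesis .
  qed
  moreover have "b * (x * y) = x * y * b" if "b * x = x * b" "b * y = y * b" for b x y :: "'h bop"
    using that by (metis mult.assoc)
  ultimately show ?thesis
    using assms unfolding unital_star_subalgebra_def von_neumann_algebra_def
    by (auto simp: distrib_left distrib_right bop_mult_scaleC_left bop_mult_scaleC_right)
qed

section \<open>Amplification to sequences and von Neumann's density theorem\<close>

text \<open>This is \<open>a \<otimes> 1\<close> on the Hilbert sum of countably many copies of the
  space. Boundedness of \<open>a\<close> keeps the sequence square-summable, so \<open>L2\<close> is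
  applied to a legitimate argument.\<close>

definition l2_amp :: "'h::chilbert_space bop \<Rightarrow> 'h l2 \<Rightarrow> 'h l2"
  where "l2_amp a z = L2 (\<lambda>n. bop_apply a (l2_nth z n))"

lemma l2_nth_amp [simp]: "l2_nth (l2_amp a z) n = bop_apply a (l2_nth z n)"
  and bounded_linear_l2_amp: "bounded_linear (l2_amp a)"
proof -
  obtain C where C: "0 \<le> C" "norm (bop_apply a x) \<le> norm x * C" for x
    using bounded_linear.nonneg_bounded[OF bounded_linear_bop_apply] by blast
  have le: "(\<Sum>n<N. (norm (bop_apply a (l2_nth z n)))\<^sup>2) \<le> (norm z * C)\<^sup>2" for N z
  proof -
    have "(\<Sum>n<N. (norm (bop_apply a (l2_nth z n)))\<^sup>2) \<le> (\<Sum>n<N. (norm (l2_nth z n) * C)\<^sup>2)"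
      by (intro sum_mono power_mono C) simp
    also have "\<dots> = (\<Sum>n<N. (norm (l2_nth z n))\<^sup>2) * C\<^sup>2"
      by (simp add: power_mult_distrib sum_distrib_right)
    also have "\<dots> \<le> (norm z)\<^sup>2 * C\<^sup>2"
      by (intro mult_right_mono sum_norm_l2_nth_le) simp
    finally show ?thesis
      by (simp add: power_mult_distrib)
  qed
  have nth: "l2_nth (l2_amp a z) n = bop_apply a (l2_nth z n)" for z n
    unfolding l2_amp_def using norm_L2_le(1)[OF le] C(1) by simp
  then show "l2_nth (l2_amp a z) n = bop_apply a (l2_nth z n)" .
  show "bounded_linear (l2_amp a)"
  proof (rule bounded_linear_intro)
    show "norm (l2_amp a z) \<le> norm z * C" for z
      unfolding l2_amp_def using norm_L2_le(2)[OF le] C(1) by simp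
  qed (auto intro!: l2_eqI simp: nth plus_l2.rep_eq scaleR_l2.rep_eq bop_apply_add bop_apply_scaleR)
qed

lemma inner_l2_amp: "l2_amp a x \<bullet> y = x \<bullet> l2_amp (adj a) y"
  unfolding inner_l2_def by (intro suminf_cong) (simp add: Re_cinner[symmetric] cinner_adj_right)

lemma l2_amp_mult: "l2_amp (a * b) x = l2_amp a (l2_amp b x)"
  by (rule l2_eqI) (simp add: bop_rep_eqs)

lemma l2_amp_single: "l2_amp a (l2_single k v) = l2_single k (bop_apply a v)"
  by (rule l2_eqI) (simp add: l2_single.rep_eq bop_apply_zero)

text \<open>The projection onto the closure of \<open>(A \<otimes> 1) y\<close> in the amplified space commutes with
  \<open>A \<otimes> 1\<close>; hence its matrix entries commute with \<open>A\<close>, so that it also commutes with \<open>a \<otimes> 1\<close> for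
  \<open>a\<close> in the bicommutant of \<open>A\<close>.\<close>

lemma double_commutant_density:
  fixes A :: "'h::chilbert_space bop set"
  assumes A: "unital_star_subalgebra A" and a: "a \<in> commutant (commutant A)"
  shows "l2_amp a y \<in> closure ((\<lambda>d. l2_amp d y) ` A)"
proof -
  note A = unital_star_subalgebraD[OF A]
  define K where "K = closure ((\<lambda>d. l2_amp d y) ` A)"
  have lin: "l2_amp d (u + v) = l2_amp d u + l2_amp d v" "l2_amp d (u - v) = l2_amp d u - l2_amp d v"
    "l2_amp d (r *\<^sub>R u) = r *\<^sub>R l2_amp d u" for d :: "'h bop" and u v r
    by (simp_all add: bounded_linear.linear[OF bounded_linear_l2_amp] linear_add linear_diff linear_scale)
  have "subspace ((\<lambda>d. l2_amp d y) ` A)"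
  proof (rule subspaceI)
    have "l2_amp (1 - 1) y = 0"
      by (rule l2_eqI) (simp add: bop_rep_eqs zero_l2.rep_eq)
    then show "0 \<in> (\<lambda>d. l2_amp d y) ` A"
      using A(1,6) by (metis imageI)
  next
    fix u v r
    assume "u \<in> (\<lambda>d. l2_amp d y) ` A" "v \<in> (\<lambda>d. l2_amp d y) ` A"
    then obtain d e where d: "d \<in> A" "u = l2_amp d y" and e: "e \<in> A" "v = l2_amp e y"
      by blast
    have "u + v = l2_amp (d + e) y" "r *\<^sub>R u = l2_amp (complex_of_real r *\<^sub>C d) y"
      by (auto intro!: l2_eqI simp: d e bop_rep_eqs plus_l2.rep_eq scaleR_l2.rep_eq scaleC_of_real bop_apply_scaleR_op)
    then show "u + v \<in> (\<lambda>d. l2_amp d y) ` A" "r *\<^sub>R u \<in> (\<lambda>d. l2_amp d y) ` A"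
      using A(2,4) d(1) e(1) by blast+
  qed
  then have K: "subspace K" "closed K"
    unfolding K_def by (simp_all add: subspace_closure)
  have yK: "y \<in> K"
  proof -
    have "l2_amp 1 y = y"
      by (rule l2_eqI) (simp add: bop_rep_eqs)
    then show ?thesis
      unfolding K_def using A(1) closure_subset by (metis image_eqI subsetD)
  qed
  have inv: "l2_amp d u \<in> K" if d: "d \<in> A" and u: "u \<in> K" for d u
  proof -
    have "l2_amp d ` K \<subseteq> K"
      unfolding K_def
    proof (rule image_closure_subset)
      show "continuous_on (closure ((\<lambda>d. l2_amp d y) ` A)) (l2_amp d)"
        by (rule linear_continuous_on[OF bounded_linear_l2_amp])
      show "l2_amp d ` (\<lambda>d. l2_amp d y) ` A \<subseteq> closure ((\<lambda>d. l2_amp d y) ` A)"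
        using A(3) d closure_subset by (fastforce simp: l2_amp_mult[symmetric])
    qed simp
    then show ?thesis
      using u by blast
  qed
  define P where "P = orth_proj K"
  have P: "bounded_linear P"
    unfolding P_def using K by (rule bounded_linear_orth_proj)
  \<comment> \<open>\<open>A\<close> is closed under adjoints, so \<open>K\<close> is invariant
    under the amplifications of both \<open>d\<close> and \<open>adj d\<close>.\<close>
  have Pcomm: "P (l2_amp d u) = l2_amp d (P u)" if d: "d \<in> A" for d u
    unfolding P_def
    by (rule orth_proj_commute[OF K, where S = "l2_amp (adj d)"])
      (simp_all add: inv d A(5) lin inner_l2_amp)
  define E where "E m n = Bop (\<lambda>v. l2_nth (P (l2_single n v)) m)" for m n
  \<comment> \<open>Multiplication by a complex scalar is the amplification of
    \<open>c *\<^sub>C 1\<close>, an element of \<open>A\<close>. Complex linearity of the matrix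
    entries \<open>E m n\<close> thus follows from \<open>Pcomm\<close>, although \<open>P\<close>
    is built as a real projection.\<close>
  have scaleC_single: "l2_single n (c *\<^sub>C v) = l2_amp (c *\<^sub>C 1) (l2_single n v)" for n c and v :: 'h
    by (simp add: l2_amp_single bop_rep_eqs)
  have single: "bounded_linear (l2_single n :: 'h \<Rightarrow> 'h l2)" for n
  proof (rule bounded_linear_intro[of _ 1])
    show "norm (l2_single n v) \<le> norm v * 1" for v :: 'h
      using suminf_finite[of "{n}" "\<lambda>k. (norm (l2_nth (l2_single n v) k))\<^sup>2"]
        norm_l2_power2[of "l2_single n v"]
      by (simp add: l2_single.rep_eq)
  qed (auto intro!: l2_eqI simp: l2_single.rep_eq plus_l2.rep_eq scaleR_l2.rep_eq)
  have E: "bop_apply (E m n) v = l2_nth (P (l2_single n v)) m" for m n v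
  proof -
    have "bounded_linear (\<lambda>v. l2_nth (P (l2_single n v)) m)"
      by (intro bounded_linear_compose[OF bounded_linear_l2_nth] bounded_linear_compose[OF P] single)
    moreover have "l2_nth (P (l2_single n (c *\<^sub>C v))) m = c *\<^sub>C l2_nth (P (l2_single n v)) m" for c v
      by (simp add: scaleC_single Pcomm A(1,4) bop_rep_eqs)
    ultimately show ?thesis
      by (simp add: E_def Bop_inverse)
  qed
  have "E m n \<in> commutant A" for m n
    unfolding commutant_def
    by (auto intro!: bop_eqI simp: bop_rep_eqs E Pcomm l2_amp_single[symmetric])
  then have aE: "E m n * a = a * E m n" for m n
    using a unfolding commutant_def by blast
  have PE: "(\<lambda>n. bop_apply (E m n) (l2_nth u n)) sums l2_nth (P u) m" for m u
    using bounded_linear.sums[OF bounded_linear_compose[OF bounded_linear_l2_nth P] l2_sums_single]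
    by (simp add: E)
  have "P (l2_amp a u) = l2_amp a (P u)" for u
  proof (rule l2_eqI)
    fix m
    have "(\<lambda>n. bop_apply (E m n) (bop_apply a (l2_nth u n))) sums l2_nth (P (l2_amp a u)) m"
      using PE[of m "l2_amp a u"] by simp
    moreover have "bop_apply (E m n) (bop_apply a v) = bop_apply a (bop_apply (E m n) v)" for n v
      using aE[of m n] by (metis times_bop.rep_eq)
    moreover have "(\<lambda>n. bop_apply a (bop_apply (E m n) (l2_nth u n))) sums bop_apply a (l2_nth (P u) m)"
      by (rule bounded_linear.sums[OF bounded_linear_bop_apply PE])
    ultimately show "l2_nth (P (l2_amp a u)) m = l2_nth (l2_amp a (P u)) m"
      by (simp add: sums_unique2)
  qed
  \<comment> \<open>Since \<open>P\<close> fixes \<open>y\<close>, commutation shows that it fixes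
    \<open>l2_amp a y\<close>, which therefore lies in the range \<open>K\<close>.\<close>
  then have "P (l2_amp a y) = l2_amp a y"
    using orth_proj_id[OF K yK] by (simp add: P_def)
  then show ?thesis
    unfolding K_def[symmetric] using orth_proj_in[OF K] by (metis P_def)
qed

section \<open>Ultraweak neighbourhoods and density\<close>

text \<open>Rewrites the pairing that generates the ultraweak topology through real inner products,
  which makes its norm continuity in \<open>z\<close> visible.\<close>

lemma suminf_cinner_l2:
  "(\<Sum>n. cinner (l2_nth x n) (l2_nth z n)) = Complex (x \<bullet> z) (- (x \<bullet> l2_amp (\<i> *\<^sub>C 1) z))"
proof -
  have "(\<lambda>n. cinner (l2_nth x n) (l2_nth z n)) sums Complex (x \<bullet> z) (- (x \<bullet> l2_amp (\<i> *\<^sub>C 1) z))"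
    using l2_inner_sums[of x z] sums_minus[OF l2_inner_sums[of x "l2_amp (\<i> *\<^sub>C 1) z"]]
    by (simp add: sums_complex_iff cinner_conv_inner bop_rep_eqs)
  then show ?thesis
    by (rule sums_unique[symmetric])
qed

text \<open>Subbasic sets are handled by norm continuity of the pairing, finite intersections by
  merging two test vectors into one. Norm density of an amplified orbit then yields ultraweak
  density.\<close>

lemma ultraweak_neighbourhood:
  assumes "openin ultraweak_topology U" and "a \<in> U"
  shows "\<exists>y e. 0 < e \<and> (\<forall>b. norm (l2_amp b y - l2_amp a y) < e \<longrightarrow> b \<in> U)"
proof -
  let ?\<B> = "{{a :: 'a bop. (\<Sum>n. cinner (x n) (bop_apply a (y n))) \<in> U} | x y U.
       summable (\<lambda>n::nat. (norm (x n))\<^sup>2) \<and> summable (\<lambda>n. (norm (y n))\<^sup>2) \<and> open U}"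
  have "generate_topology_on ?\<B> U"
    using assms(1) unfolding ultraweak_topology_def openin_topology_generated_by_iff .
  then show ?thesis
    using assms(2)
  proof (induction arbitrary: a rule: generate_topology_on.induct)
    case Empty
    then show ?case
      by simp
  next
    case (Int U V)
    then obtain y e z f where y: "0 < e" "\<And>b. norm (l2_amp b y - l2_amp a y) < e \<Longrightarrow> b \<in> U"
      and z: "0 < f" "\<And>b. norm (l2_amp b z - l2_amp a z) < f \<Longrightarrow> b \<in> V"
      by (metis IntD1 IntD2)
    \<comment> \<open>Interleaves \<open>y\<close> at even and \<open>z\<close> at odd positions, so
      that the squared norms of the amplified vectors add and the single vector \<open>w\<close>
      dominates both.\<close>
    define w where "w n = (if even n then l2_nth y (n div 2) else l2_nth z ((n - 1) div 2))" for n
    have sums: "(\<lambda>n. (norm (bop_apply d (w n)))\<^sup>2) sums ((norm (l2_amp d y))\<^sup>2 + (norm (l2_amp d z))\<^sup>2)" for d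
    proof -
      have "(\<lambda>n. (norm (bop_apply d (l2_nth v n)))\<^sup>2) sums (norm (l2_amp d v))\<^sup>2" for v
        using summable_sums[OF summable_l2_nth[of "l2_amp d v"]] by (simp add: norm_l2_power2)
      from sums_if[OF this[of z] this[of y]] show ?thesis
        by (simp add: w_def if_distrib[of "\<lambda>v. (norm (bop_apply d v))\<^sup>2"] add.commute)
    qed
    have "l2_nth (L2 w) = w"
      using sums_summable[OF sums[of 1]] by (simp add: bop_rep_eqs)
    then have norm: "(norm (l2_amp d (L2 w)))\<^sup>2 = (norm (l2_amp d y))\<^sup>2 + (norm (l2_amp d z))\<^sup>2" for d
      using sums_unique[OF sums[of d]] by (simp add: norm_l2_power2)
    have amp_diff: "l2_amp b v - l2_amp a v = l2_amp (b - a) v" for b v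
      by (rule l2_eqI) (simp add: minus_l2.rep_eq bop_rep_eqs)
    have "norm (l2_amp d y) \<le> norm (l2_amp d (L2 w))" "norm (l2_amp d z) \<le> norm (l2_amp d (L2 w))" for d
      by (rule power2_le_imp_le; simp add: norm)+
    then have "b \<in> U \<inter> V" if "norm (l2_amp b (L2 w) - l2_amp a (L2 w)) < min e f" for b
      using that y(2)[of b] z(2)[of b] unfolding amp_diff by (meson IntI le_less_trans min_less_iff_conj)
    then show ?case
      using y(1) z(1) by (intro exI[of _ "L2 w"] exI[of _ "min e f"]) simp
  next
    case (UN K)
    then obtain k where "k \<in> K" "a \<in> k"
      by blast
    with UN.IH[of k a] show ?case
      by blast
  next
    case (Basis S)
    then obtain x y V where S: "S = {a. (\<Sum>n. cinner (x n) (bop_apply a (y n))) \<in> V}"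
      and xy: "summable (\<lambda>n. (norm (x n))\<^sup>2)" "summable (\<lambda>n. (norm (y n))\<^sup>2)" and V: "open V"
      by blast
    \<comment> \<open>The complex pairing as a norm continuous function of the amplified vector; a
      ball inside the preimage of \<open>V\<close> provides \<open>e\<close>.\<close>
    define F where "F z = Complex (L2 x \<bullet> z) (- (L2 x \<bullet> l2_amp (\<i> *\<^sub>C 1) z))" for z :: "'a l2"
    have F: "(\<Sum>n. cinner (x n) (bop_apply b (y n))) = F (l2_amp b (L2 y))" for b
      using suminf_cinner_l2[of "L2 x" "l2_amp b (L2 y)"] xy by (simp add: F_def)
    have "continuous_on UNIV F"
      unfolding F_def Complex_eq
      by (intro continuous_intros linear_continuous_on[OF bounded_linear_l2_amp])
    then have "open (F -` V)"
      using V by (simp add: continuous_on_open_vimage)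
    moreover have "l2_amp a (L2 y) \<in> F -` V"
      using Basis.prems by (simp add: S F)
    ultimately obtain e where "0 < e" "\<And>z. dist z (l2_amp a (L2 y)) < e \<Longrightarrow> z \<in> F -` V"
      unfolding open_dist by blast
    then show ?case
      by (intro exI[of _ "L2 y"] exI[of _ e]) (simp add: S F dist_norm)
  qed
qed

lemma double_commutant_subset_ultraweak_closure:
  assumes "unital_star_subalgebra A" and "a \<in> commutant (commutant A)"
    and "openin ultraweak_topology U" and "a \<in> U"
  shows "A \<inter> U \<noteq> {}"
proof -
  obtain y e where "0 < e" and e: "\<And>b. norm (l2_amp b y - l2_amp a y) < e \<Longrightarrow> b \<in> U"
    using ultraweak_neighbourhood[OF assms(3,4)] by blast
  then obtain d where "d \<in> A" "norm (l2_amp d y - l2_amp a y) < e"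
    using double_commutant_density[OF assms(1,2), of y] by (auto simp: closure_approachable dist_norm)
  then show ?thesis
    using e by blast
qed

lemma topspace_ultraweak [simp]: "topspace (ultraweak_topology :: 'h::chilbert_space bop topology) = UNIV"
proof -
  have "openin (ultraweak_topology :: 'h bop topology) {a. (\<Sum>n. cinner ((\<lambda>_. 0) n) (bop_apply a ((\<lambda>_. 0) n))) \<in> UNIV}"
    unfolding ultraweak_topology_def
    by (rule topology_generated_by_Basis) (intro CollectI exI conjI, rule refl, simp_all)
  then show ?thesis
    using openin_subset by fastforce
qed

text \<open>A matrix coefficient is the pairing of two sequences supported at index 0, so its
  preimages of open sets are among the generating sets.\<close>

lemma continuous_map_cinner:
  "continuous_map ultraweak_topology euclidean (\<lambda>a. cinner x (bop_apply a y))"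
proof -
  have "openin ultraweak_topology {a. cinner x (bop_apply a y) \<in> U}" if "open U" for U
  proof -
    let ?s = "\<lambda>v n. if n = (0::nat) then v else 0"
    have "openin ultraweak_topology {a. (\<Sum>n. cinner (?s x n) (bop_apply a (?s y n))) \<in> U}"
      unfolding ultraweak_topology_def
    proof (rule topology_generated_by_Basis, intro CollectI exI conjI)
      show "summable (\<lambda>n. (norm (?s x n))\<^sup>2)" "summable (\<lambda>n. (norm (?s y n))\<^sup>2)"
        by (rule summable_finite[of "{0}"]; simp)+
    qed (rule refl, fact)
    moreover have "(\<Sum>n. cinner (?s x n) (bop_apply a (?s y n))) = cinner x (bop_apply a y)" for a
      by (subst suminf_finite[of "{0}"]) (auto simp: bop_apply_zero)
    ultimately show ?thesis
      by simp
  qed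
  then show ?thesis
    by (simp add: continuous_map_def)
qed

text \<open>\<open>A\<close> is ultraweakly dense in its bicommutant and quadratic forms separate
  operators, so equations between continuous maps extend; membership in \<open>M\<close> comes from
  monotonicity of the bicommutant.\<close>

lemma ultraweak_equalizer_double_commutant:
  assumes M: "von_neumann_algebra M" and A: "unital_star_subalgebra A" "A \<subseteq> M"
    and F: "continuous_map (subtopology ultraweak_topology M) (subtopology ultraweak_topology M) F"
    and G: "continuous_map (subtopology ultraweak_topology M) (subtopology ultraweak_topology M) G"
    and eq: "\<And>d. d \<in> A \<Longrightarrow> F d = G d"
    and a: "a \<in> commutant (commutant A)"
  shows "a \<in> M" and "F a = G a"
proof -
  show aM: "a \<in> M"
    using a commutant_antimono[OF commutant_antimono[OF A(2)]] M
    by (auto simp: von_neumann_algebra_def)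
  show "F a = G a"
  proof (rule bop_eq_quadratic_formI)
    fix x
    have cont: "continuous_map (subtopology ultraweak_topology M) euclidean (\<lambda>b. cinner x (bop_apply (H b) x))"
      if "continuous_map (subtopology ultraweak_topology M) (subtopology ultraweak_topology M) H" for H
      using continuous_map_compose[OF continuous_map_into_fulltopology[OF that] continuous_map_cinner[of x x]]
      by (simp add: o_def)
    \<comment> \<open>If \<open>F a\<close> and \<open>G a\<close> differed in the quadratic form at
      \<open>x\<close>, then \<open>h\<close> would be nonzero on a neighbourhood of
      \<open>a\<close> in \<open>M\<close>, which contains a point of \<open>A\<close>.\<close>
    define h where "h b = cinner x (bop_apply (F b) x) - cinner x (bop_apply (G b) x)" for b
    have h: "continuous_map (subtopology ultraweak_topology M) euclidean h"
      unfolding h_def by (intro continuous_intros cont F G)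
    show "cinner x (bop_apply (F a) x) = cinner x (bop_apply (G a) x)"
    proof (rule ccontr)
      assume "cinner x (bop_apply (F a) x) \<noteq> cinner x (bop_apply (G a) x)"
      then have "a \<in> {b \<in> M. h b \<in> - {0}}"
        using aM by (simp add: h_def)
      moreover have "openin (subtopology ultraweak_topology M) {b \<in> M. h b \<in> - {0}}"
        using openin_continuous_map_preimage[OF h, of "- {0}"] by (simp add: open_Compl)
      ultimately obtain U where U: "openin ultraweak_topology U" "a \<in> U" "U \<inter> M = {b \<in> M. h b \<in> - {0}}"
        by (auto simp: openin_subtopology)
      then obtain d where "d \<in> A" "d \<in> U"
        using double_commutant_subset_ultraweak_closure[OF A(1) a] by blast
      then have "h d \<noteq> 0"
        using U(3) A(2) by blast
      then show False
        using eq[OF \<open>d \<in> A\<close>] by (simp add: h_def)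
    qed
  qed
qed

section \<open>Schwartz maps and invariant states\<close>

lemma bop_diff_nonneg_iff: "0 \<le> b - a \<longleftrightarrow> a \<le> b" for a b :: "'h::chilbert_space bop"
  by (simp add: less_eq_bop_def)

text \<open>Positivity on \<open>1 + c *\<^sub>C x\<close> makes the cross terms real. The choice
  \<open>c = 1\<close> compares the imaginary parts of the two values, and \<open>c = \<i>\<close>
  compares the real parts.\<close>

lemma positive_functional_adj:
  fixes \<omega> :: "'h::chilbert_space bop \<Rightarrow> complex"
  assumes A: "unital_star_subalgebra A" and lin: "clinear_on A \<omega>"
    and pos: "\<And>a. a \<in> A \<Longrightarrow> \<omega> (adj a * a) \<in> \<real>\<^sub>\<ge>\<^sub>0" and x: "x \<in> A"
  shows "\<omega> (adj x) = cnj (\<omega> x)"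
proof -
  note A = unital_star_subalgebraD[OF A]
  have add: "\<And>a b. a \<in> A \<Longrightarrow> b \<in> A \<Longrightarrow> \<omega> (a + b) = \<omega> a + \<omega> b"
    and scale: "\<And>a c. a \<in> A \<Longrightarrow> \<omega> (c *\<^sub>C a) = c * \<omega> a"
    using lin by (simp_all add: clinear_on_def scaleC_complex_def)
  have "Im (c * \<omega> x + cnj c * \<omega> (adj x)) = 0" for c
  proof -
    have "adj (1 + c *\<^sub>C x) * (1 + c *\<^sub>C x) = 1 + (c *\<^sub>C x + (cnj c *\<^sub>C adj x + adj (c *\<^sub>C x) * (c *\<^sub>C x)))"
      by (simp add: adj_add adj_scaleC distrib_left distrib_right add.assoc)
    moreover have "\<omega> (1 + (c *\<^sub>C x + (cnj c *\<^sub>C adj x + adj (c *\<^sub>C x) * (c *\<^sub>C x)))) =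
        \<omega> 1 + (c * \<omega> x + (cnj c * \<omega> (adj x) + \<omega> (adj (c *\<^sub>C x) * (c *\<^sub>C x))))"
      by (simp add: add scale A x)
    ultimately have "Im (\<omega> 1) + (Im (c * \<omega> x + cnj c * \<omega> (adj x)) + Im (\<omega> (adj (c *\<^sub>C x) * (c *\<^sub>C x)))) = 0"
      using pos[of "1 + c *\<^sub>C x"] A x by (simp add: complex_nonneg_Reals_iff)
    moreover have "Im (\<omega> 1) = 0" "Im (\<omega> (adj (c *\<^sub>C x) * (c *\<^sub>C x))) = 0"
      using pos[of 1] pos[of "c *\<^sub>C x"] A x by (simp_all add: complex_nonneg_Reals_iff)
    ultimately show ?thesis
      by simp
  qed
  from this[of 1] this[of \<i>] show ?thesis
    by (simp add: complex_eq_iff)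
qed

text \<open>The Schwartz inequality makes \<Phi> positive on elements \<open>adj a * a\<close>, so
  every vector functional composed with \<Phi> is Hermitian.\<close>

lemma schwartz_map_adj:
  fixes M :: "'h::chilbert_space bop set"
  assumes M: "unital_star_subalgebra M" and \<Phi>: "unital_schwartz_map M \<Phi>" and a: "a \<in> M"
  shows "\<Phi> (adj a) = adj (\<Phi> a)"
proof (rule bop_eq_quadratic_formI)
  fix x
  have "cinner x (bop_apply (\<Phi> (adj a)) x) = cnj (cinner x (bop_apply (\<Phi> a) x))"
  proof (rule positive_functional_adj[OF M _ _ a])
    show "clinear_on M (\<lambda>a. cinner x (bop_apply (\<Phi> a) x))"
      using \<Phi> by (simp add: unital_schwartz_map_def clinear_on_def bop_rep_eqs cinner_add_right
          cinner_scaleC_right scaleC_complex_def)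
    show "cinner x (bop_apply (\<Phi> (adj a * a)) x) \<in> \<real>\<^sub>\<ge>\<^sub>0" if "a \<in> M" for a
    proof -
      have "0 \<le> \<Phi> (adj a * a)"
        using \<Phi> that unfolding unital_schwartz_map_def by (metis order_trans)
      then show ?thesis
        by (simp add: less_eq_bop_def)
    qed
  qed
  then show "cinner x (bop_apply (\<Phi> (adj a)) x) = cinner x (bop_apply (adj (\<Phi> a)) x)"
    by (simp add: cinner_adj_right flip: cinner_commute)
qed

lemma schwartz_map_le:
  fixes M :: "'h::chilbert_space bop set"
  assumes "unital_star_subalgebra M" and "unital_schwartz_map M \<Phi>" and "a \<in> M"
  shows "adj (\<Phi> a) * \<Phi> a \<le> \<Phi> (adj a * a)"
  using assms(2,3) schwartz_map_adj[OF assms] unfolding unital_schwartz_map_def by metis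

text \<open>Being real for all \<open>t\<close> forces \<open>B = cnj C\<close>. The expression then
  has real part \<open>Re A + 2 * Re (t * B)\<close>, which is unbounded below unless
  \<open>B\<close> vanishes.\<close>

lemma nonneg_Reals_pencil:
  assumes nonneg: "\<And>t. A + t * B + cnj t * C \<in> \<real>\<^sub>\<ge>\<^sub>0"
  shows "B = 0"
proof -
  have Im: "Im A + Im (t * B + cnj t * C) = 0" and Re: "0 \<le> Re A + Re (t * B + cnj t * C)" for t
    using nonneg[of t] by (simp_all add: complex_nonneg_Reals_iff add.assoc)
  have "B = cnj C"
    using Im[of 0] Im[of 1] Im[of \<i>] by (simp add: complex_eq_iff)
  show ?thesis
  proof (rule ccontr)
    assume "B \<noteq> 0"
    \<comment> \<open>Chosen so that \<open>t = - s * cnj B\<close> makes the real part exactly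
      -1.\<close>
    define s where "s = (Re A + 1) / (2 * (cmod B)\<^sup>2)"
    have "0 \<le> Re A + Re (- complex_of_real s * cnj B * B + cnj (- complex_of_real s * cnj B) * C)"
      by (rule Re)
    also have "\<dots> = Re A - 2 * s * (cmod B)\<^sup>2"
    proof -
      have "(cmod C)\<^sup>2 = Re C * Re C + Im C * Im C"
        unfolding cmod_power2 by (simp only: power2_eq_square)
      then show ?thesis
        by (simp add: \<open>B = cnj C\<close> algebra_simps)
    qed
    also have "\<dots> = - 1"
      using \<open>B \<noteq> 0\<close> by (simp add: s_def field_simps)
    finally show False
      by simp
  qed
qed

text \<open>Polarisation: the sesquilinear form \<open>\<Phi>(x\<^sup>* y) - \<Phi>(x)\<^sup>* \<Phi>(y)\<close> is positive by the Schwartz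
  inequality, so a vector on which it vanishes lies in its kernel.\<close>

lemma schwartz_map_mult:
  fixes M :: "'h::chilbert_space bop set"
  assumes M: "unital_star_subalgebra M" and \<Phi>: "unital_schwartz_map M \<Phi>"
    and a: "a \<in> M" "\<Phi> (adj a * a) = adj (\<Phi> a) * \<Phi> a" and b: "b \<in> M"
  shows "\<Phi> (b * a) = \<Phi> b * \<Phi> a"
proof -
  note A = unital_star_subalgebraD[OF M]
  have add: "\<And>a b. a \<in> M \<Longrightarrow> b \<in> M \<Longrightarrow> \<Phi> (a + b) = \<Phi> a + \<Phi> b"
    and scale: "\<And>a c. a \<in> M \<Longrightarrow> \<Phi> (c *\<^sub>C a) = c *\<^sub>C \<Phi> a"
    using \<Phi> by (simp_all add: unital_schwartz_map_def clinear_on_def)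
  note star = schwartz_map_adj[OF M \<Phi>]
  define \<Delta> where "\<Delta> x y = \<Phi> (adj x * y) - adj (\<Phi> x) * \<Phi> y" for x y
  have \<Delta>: "0 \<le> \<Delta> x x" if "x \<in> M" for x
    using schwartz_map_le[OF M \<Phi> that] by (simp add: \<Delta>_def bop_diff_nonneg_iff)
  \<comment> \<open>The first argument of \<Delta> enters through its adjoint, so
    \<open>\<Delta> x a\<close> is precisely the failure of \<Phi> to be multiplicative on
    \<open>b * a\<close>.\<close>
  define x where "x = adj b"
  have x: "x \<in> M"
    using A b by (simp add: x_def)
  \<comment> \<open>The term in \<open>cnj t * t\<close> is absent because
    \<open>\<Delta> a a = 0\<close>. What remains is affine in \<open>t\<close> and
    \<open>cnj t\<close>, as \<open>nonneg_Reals_pencil\<close> requires.\<close>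
  have "\<Delta> (x + t *\<^sub>C a) (x + t *\<^sub>C a) = \<Delta> x x + t *\<^sub>C \<Delta> x a + cnj t *\<^sub>C \<Delta> a x" for t
  proof -
    have "\<Phi> (adj (x + t *\<^sub>C a) * (x + t *\<^sub>C a)) =
        \<Phi> (adj x * x + (t *\<^sub>C (adj x * a) + (cnj t *\<^sub>C (adj a * x) + (cnj t * t) *\<^sub>C (adj a * a))))"
      by (simp add: adj_add adj_scaleC distrib_left distrib_right bop_mult_scaleC_left
          bop_mult_scaleC_right scaleC_scaleC scaleC_add_right mult.commute add_ac)
    also have "\<dots> = \<Phi> (adj x * x) + (t *\<^sub>C \<Phi> (adj x * a) + (cnj t *\<^sub>C \<Phi> (adj a * x) + (cnj t * t) *\<^sub>C (adj (\<Phi> a) * \<Phi> a)))"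
      unfolding a(2)[symmetric] by (simp add: add scale A x a(1))
    finally show ?thesis
      by (simp add: \<Delta>_def a(2) add scale A x a(1) adj_add adj_scaleC distrib_left distrib_right
          bop_mult_scaleC_left bop_mult_scaleC_right scaleC_scaleC scaleC_diff_right scaleC_add_right mult.commute)
  qed
  then have "0 \<le> \<Delta> x x + t *\<^sub>C \<Delta> x a + cnj t *\<^sub>C \<Delta> a x" for t
    using \<Delta>[of "x + t *\<^sub>C a"] A x a(1) by simp
  then have nonneg: "cinner \<xi> (bop_apply (\<Delta> x x) \<xi>) + t * cinner \<xi> (bop_apply (\<Delta> x a) \<xi>) +
      cnj t * cinner \<xi> (bop_apply (\<Delta> a x) \<xi>) \<in> \<real>\<^sub>\<ge>\<^sub>0" for \<xi> t
    by (simp add: less_eq_bop_def bop_rep_eqs cinner_add_right cinner_scaleC_right)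
  have "\<Delta> x a = 0"
    by (rule bop_eq_quadratic_formI) (simp add: bop_rep_eqs nonneg_Reals_pencil[OF nonneg])
  then show ?thesis
    using star[OF x] by (simp add: \<Delta>_def x_def)
qed

section \<open>A Schwartz map together with its state adjoint\<close>

text \<open>The setting is symmetric in the two maps, as \<open>swap\<close> shows; each result
  about \<Phi> can then be reused for \<open>\<Phi>s\<close>.\<close>

locale schwartz_pair =
  fixes M :: "'h::chilbert_space bop set" and \<Phi> \<Phi>s :: "'h bop \<Rightarrow> 'h bop" and \<phi> :: "'h bop \<Rightarrow> complex"
  assumes von_neumann: "von_neumann_algebra M"
    and schwartz: "unital_schwartz_map M \<Phi>" and schwartz': "unital_schwartz_map M \<Phi>s"
    and state: "normal_faithful_state M \<phi>"
    and adjoint: "a \<in> M \<Longrightarrow> b \<in> M \<Longrightarrow> \<phi> (b * \<Phi> a) = \<phi> (\<Phi>s b * a)"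
begin

lemmas subalgebra = von_neumann_algebra_imp_unital_star_subalgebra[OF von_neumann]
lemmas mem = unital_star_subalgebraD[OF subalgebra]

lemma map_mem: "a \<in> M \<Longrightarrow> \<Phi> a \<in> M" "a \<in> M \<Longrightarrow> \<Phi>s a \<in> M"
  using schwartz schwartz' by (auto simp: unital_schwartz_map_def)

lemma map_one: "\<Phi> 1 = 1" "\<Phi>s 1 = 1"
  using schwartz schwartz' by (auto simp: unital_schwartz_map_def)

lemma map_add: "a \<in> M \<Longrightarrow> b \<in> M \<Longrightarrow> \<Phi> (a + b) = \<Phi> a + \<Phi> b"
  and map_scaleC: "a \<in> M \<Longrightarrow> \<Phi> (c *\<^sub>C a) = c *\<^sub>C \<Phi> a"
  using schwartz by (auto simp: unital_schwartz_map_def clinear_on_def)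

lemmas map_adj = schwartz_map_adj[OF subalgebra schwartz] schwartz_map_adj[OF subalgebra schwartz']

lemma state_diff: "a \<in> M \<Longrightarrow> b \<in> M \<Longrightarrow> \<phi> (a - b) = \<phi> a - \<phi> b"
proof -
  assume ab: "a \<in> M" "b \<in> M"
  have "\<phi> (a + (- 1) *\<^sub>C b) = \<phi> a + (- 1) * \<phi> b"
    using state ab mem(4)[OF ab(2), of "- 1"]
    unfolding normal_faithful_state_def clinear_on_def scaleC_complex_def by metis
  then show "\<phi> (a - b) = \<phi> a - \<phi> b"
    by (simp add: scaleC_minus_one)
qed

lemma state_nonneg: "a \<in> M \<Longrightarrow> 0 \<le> a \<Longrightarrow> \<phi> a \<in> \<real>\<^sub>\<ge>\<^sub>0"
  and state_faithful: "a \<in> M \<Longrightarrow> 0 \<le> a \<Longrightarrow> \<phi> a = 0 \<Longrightarrow> a = 0"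
  using state by (auto simp: normal_faithful_state_def)

lemma state_adj: "a \<in> M \<Longrightarrow> \<phi> (adj a) = cnj (\<phi> a)"
  using state
  by (intro positive_functional_adj[OF subalgebra])
    (auto simp: normal_faithful_state_def adj_mult_self_nonneg mem)

text \<open>Faithfulness applied to \<open>adj (a - b) * (a - b)\<close>. A single test element
  suffices, and it stays in any *-subalgebra containing \<open>a\<close> and
  \<open>b\<close>.\<close>

lemma state_separating:
  assumes a: "a \<in> M" and b: "b \<in> M" and eq: "\<phi> (adj (a - b) * a) = \<phi> (adj (a - b) * b)"
  shows "a = b"
proof -
  have "adj (a - b) * (a - b) = adj (a - b) * a - adj (a - b) * b"
    by (rule right_diff_distrib)
  then have "\<phi> (adj (a - b) * (a - b)) = 0"
    using state_diff[of "adj (a - b) * a" "adj (a - b) * b"] a b eq by (simp add: mem)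
  then have "adj (a - b) * (a - b) = 0"
    using a b by (intro state_faithful) (simp_all add: mem adj_mult_self_nonneg)
  then show ?thesis
    using adj_mult_self_eq_0D[of "a - b"] by simp
qed

text \<open>Taking adjoints reverses products, and \<phi> and both maps are compatible with
  adjoints, so the relation moves to the other side.\<close>

lemma adjoint':
  assumes "a \<in> M" and "b \<in> M"
  shows "\<phi> (\<Phi> a * b) = \<phi> (a * \<Phi>s b)"
proof -
  have "\<phi> (adj b * \<Phi> (adj a)) = \<phi> (\<Phi>s (adj b) * adj a)"
    using assms by (intro adjoint mem)
  then have "\<phi> (adj (\<Phi> a * b)) = \<phi> (adj (a * \<Phi>s b))"
    using assms by (simp add: map_adj adj_mult)
  then show ?thesis
    using assms by (simp add: state_adj mem map_mem)
qed

lemma swap: "schwartz_pair M \<Phi>s \<Phi> \<phi>"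
  using von_neumann schwartz schwartz' state adjoint' by unfold_locales simp_all

lemma state_invariant: "a \<in> M \<Longrightarrow> \<phi> (\<Phi> a) = \<phi> a"
  using adjoint[of a 1] by (simp add: map_one mem)

text \<open>The Schwartz defect \<open>p\<close> is positive, and by invariance
  \<open>\<phi> p\<close> is the difference of the two sides. When it vanishes, faithfulness gives
  \<open>p = 0\<close>.\<close>

lemma Re_state_map_le: "a \<in> M \<Longrightarrow> Re (\<phi> (adj (\<Phi> a) * \<Phi> a)) \<le> Re (\<phi> (adj a * a))"
  and map_adj_mult_self_if_Re_state_eq:
    "a \<in> M \<Longrightarrow> Re (\<phi> (adj (\<Phi> a) * \<Phi> a)) = Re (\<phi> (adj a * a)) \<Longrightarrow> \<Phi> (adj a * a) = adj (\<Phi> a) * \<Phi> a"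
proof -
  assume a: "a \<in> M"
  define p where "p = \<Phi> (adj a * a) - adj (\<Phi> a) * \<Phi> a"
  have p: "p \<in> M" "0 \<le> p"
    using a schwartz_map_le[OF subalgebra schwartz a]
    by (simp_all add: p_def mem map_mem bop_diff_nonneg_iff)
  have "\<phi> p = \<phi> (adj a * a) - \<phi> (adj (\<Phi> a) * \<Phi> a)"
    using a by (simp add: p_def state_diff state_invariant mem map_mem)
  then have nonneg: "\<phi> p \<in> \<real>\<^sub>\<ge>\<^sub>0" and Re: "Re (\<phi> p) = Re (\<phi> (adj a * a)) - Re (\<phi> (adj (\<Phi> a) * \<Phi> a))"
    using state_nonneg[OF p] by simp_all
  then show "Re (\<phi> (adj (\<Phi> a) * \<Phi> a)) \<le> Re (\<phi> (adj a * a))"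
    by (simp add: complex_nonneg_Reals_iff)
  assume "Re (\<phi> (adj (\<Phi> a) * \<Phi> a)) = Re (\<phi> (adj a * a))"
  then have "\<phi> p = 0"
    using nonneg Re by (simp add: complex_nonneg_Reals_iff complex_eq_iff)
  then show "\<Phi> (adj a * a) = adj (\<Phi> a) * \<Phi> a"
    using state_faithful[OF p] by (simp add: p_def)
qed

text \<open>If \<open>\<Phi>s\<close> undoes \<Phi> at \<open>a\<close>, the adjoint relation shows
  that no norm is lost. Conversely, equality makes \<Phi> multiplicative against \<open>a\<close>,
  so invariance gives \<open>\<Phi>s (\<Phi> a)\<close> and \<open>a\<close> the same pairing with
  every \<open>b\<close>.\<close>

lemma adjoint_map_eq_iff:
  assumes a: "a \<in> M"
  shows "\<Phi>s (\<Phi> a) = a \<longleftrightarrow> \<Phi> (adj a * a) = adj (\<Phi> a) * \<Phi> a"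
proof
  assume "\<Phi>s (\<Phi> a) = a"
  then have "\<phi> (adj (\<Phi> a) * \<Phi> a) = \<phi> (adj a * a)"
    using a adjoint'[of "adj a" "\<Phi> a"] by (simp add: map_adj mem map_mem)
  then show "\<Phi> (adj a * a) = adj (\<Phi> a) * \<Phi> a"
    using a by (simp add: map_adj_mult_self_if_Re_state_eq)
next
  assume eq: "\<Phi> (adj a * a) = adj (\<Phi> a) * \<Phi> a"
  have "\<phi> (b * \<Phi>s (\<Phi> a)) = \<phi> (b * a)" if b: "b \<in> M" for b
  proof -
    have "\<phi> (b * \<Phi>s (\<Phi> a)) = \<phi> (\<Phi> b * \<Phi> a)"
      using a b by (simp add: adjoint' map_mem)
    also have "\<dots> = \<phi> (\<Phi> (b * a))"
      by (simp add: schwartz_map_mult[OF subalgebra schwartz a eq b])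
    also have "\<dots> = \<phi> (b * a)"
      using a b by (simp add: state_invariant mem)
    finally show ?thesis .
  qed
  then show "\<Phi>s (\<Phi> a) = a"
    using a by (intro state_separating) (simp_all add: mem map_mem)
qed

lemma map_mult:
  assumes a: "a \<in> M" "\<Phi>s (\<Phi> a) = a" and b: "b \<in> M"
  shows "\<Phi> (b * a) = \<Phi> b * \<Phi> a" and "\<Phi> (a * b) = \<Phi> a * \<Phi> b"
proof -
  show "\<Phi> (b * a) = \<Phi> b * \<Phi> a"
    using a b adjoint_map_eq_iff by (intro schwartz_map_mult[OF subalgebra schwartz]) simp_all
  have "\<Phi> (adj b * adj a) = \<Phi> (adj b) * \<Phi> (adj a)"
    using a b adjoint_map_eq_iff[of "adj a"]
    by (intro schwartz_map_mult[OF subalgebra schwartz]) (simp_all add: mem map_mem map_adj)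
  then have "adj (\<Phi> (a * b)) = adj (\<Phi> a * \<Phi> b)"
    using a b by (simp add: adj_mult mem map_adj(1)[symmetric])
  then show "\<Phi> (a * b) = \<Phi> a * \<Phi> b"
    by (metis adj_adj)
qed

lemma funpow_mem: "a \<in> M \<Longrightarrow> (\<Phi> ^^ n) a \<in> M"
  by (induction n) (simp_all add: map_mem)

lemma funpow_adj: "a \<in> M \<Longrightarrow> (\<Phi> ^^ n) (adj a) = adj ((\<Phi> ^^ n) a)"
  by (induction n) (simp_all add: map_adj funpow_mem)

lemma funpow_mult:
  assumes "a \<in> M" "b \<in> M" and "\<And>j. j < n \<Longrightarrow> \<Phi>s (\<Phi> ((\<Phi> ^^ j) a)) = (\<Phi> ^^ j) a"
  shows "(\<Phi> ^^ n) (a * b) = (\<Phi> ^^ n) a * (\<Phi> ^^ n) b"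
  using assms(3) by (induction n) (simp_all add: map_mult(2) funpow_mem assms(1,2))

text \<open>The numbers \<open>q j\<close> decrease along the orbit. For \<open>a\<close> in the
  multiplicative domain the first and last agree, so every single step preserves \<open>q\<close>.
  Conversely, multiplicativity of the individual steps composes.\<close>

lemma multiplicative_domain_funpow:
  "multiplicative_domain M (\<Phi> ^^ n) = {a \<in> M. \<forall>j<n. \<Phi>s (\<Phi> ((\<Phi> ^^ j) a)) = (\<Phi> ^^ j) a}"
proof (intro equalityI subsetI)
  fix a
  assume "a \<in> multiplicative_domain M (\<Phi> ^^ n)"
  then have a: "a \<in> M" and eq: "(\<Phi> ^^ n) (adj a * a) = adj ((\<Phi> ^^ n) a) * (\<Phi> ^^ n) a"
    by (simp_all add: multiplicative_domain_def funpow_adj)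
  \<comment> \<open>The squared GNS norm of the \<open>j\<close>-th iterate of
    \<open>a\<close>.\<close>
  define q where "q j = Re (\<phi> (adj ((\<Phi> ^^ j) a) * (\<Phi> ^^ j) a))" for j
  have "\<phi> ((\<Phi> ^^ j) b) = \<phi> b" if "b \<in> M" for b j
    by (induction j) (simp_all add: that state_invariant funpow_mem)
  then have q_n: "q n = q 0"
    using a by (simp add: q_def eq[symmetric] mem)
  have antimono: "q j \<le> q i" if "i \<le> j" for i j
    by (rule lift_Suc_antimono_le[OF _ that]) (simp add: q_def a Re_state_map_le funpow_mem)
  have "\<Phi>s (\<Phi> ((\<Phi> ^^ j) a)) = (\<Phi> ^^ j) a" if "j < n" for j
  proof -
    have "q (Suc j) = q j"
      using antimono[of 0 j] antimono[of j "Suc j"] antimono[of "Suc j" n] q_n that by simp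
    then show ?thesis
      using a by (simp add: q_def adjoint_map_eq_iff map_adj_mult_self_if_Re_state_eq funpow_mem)
  qed
  then show "a \<in> {a \<in> M. \<forall>j<n. \<Phi>s (\<Phi> ((\<Phi> ^^ j) a)) = (\<Phi> ^^ j) a}"
    using a by blast
next
  fix a
  assume "a \<in> {a \<in> M. \<forall>j<n. \<Phi>s (\<Phi> ((\<Phi> ^^ j) a)) = (\<Phi> ^^ j) a}"
  then have a: "a \<in> M" "\<And>j. j < n \<Longrightarrow> \<Phi>s (\<Phi> ((\<Phi> ^^ j) a)) = (\<Phi> ^^ j) a"
    by auto
  \<comment> \<open>The orbit condition is stable under adjoints, so it covers both
    \<open>adj a * a\<close> and \<open>a * adj a\<close>.\<close>
  moreover have "\<Phi>s (\<Phi> ((\<Phi> ^^ j) (adj a))) = (\<Phi> ^^ j) (adj a)" if "j < n" for j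
    using a(1) a(2)[OF that] by (simp add: funpow_adj funpow_mem map_mem map_adj)
  ultimately show "a \<in> multiplicative_domain M (\<Phi> ^^ n)"
    by (simp add: multiplicative_domain_def funpow_mult mem)
qed

end

section \<open>The reversible part as a von Neumann algebra\<close>

text \<open>The orbit descriptions of all multiplicative domains are combined: \<Phi> is followed
  along the forward orbit and \<open>\<Phi>s\<close> along the backward one.\<close>

definition reversible_part ::
    "'h::chilbert_space bop set \<Rightarrow> ('h bop \<Rightarrow> 'h bop) \<Rightarrow> ('h bop \<Rightarrow> 'h bop) \<Rightarrow> 'h bop set"
  where "reversible_part M \<Phi> \<Phi>s = {a \<in> M. \<forall>j. \<Phi>s (\<Phi> ((\<Phi> ^^ j) a)) = (\<Phi> ^^ j) a \<and>
    \<Phi> (\<Phi>s ((\<Phi>s ^^ j) a)) = (\<Phi>s ^^ j) a}"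

lemma reversible_part_commute: "reversible_part M \<Phi>s \<Phi> = reversible_part M \<Phi> \<Phi>s"
  by (auto simp: reversible_part_def)

text \<open>Orbits of points of \<open>B\<close> stay in \<open>B\<close>, where the maps are
  mutually inverse. Membership can thus be checked for whole sets without following orbits.\<close>

lemma reversible_part_greatest:
  assumes "B \<subseteq> M" and "\<And>b. b \<in> B \<Longrightarrow> \<Phi> b \<in> B" and "\<And>b. b \<in> B \<Longrightarrow> \<Phi>s b \<in> B"
    and "\<And>b. b \<in> B \<Longrightarrow> \<Phi>s (\<Phi> b) = b" and "\<And>b. b \<in> B \<Longrightarrow> \<Phi> (\<Phi>s b) = b"
  shows "B \<subseteq> reversible_part M \<Phi> \<Phi>s"
proof
  fix b
  assume b: "b \<in> B"
  have "(\<Phi> ^^ j) b \<in> B" "(\<Phi>s ^^ j) b \<in> B" for j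
    by (induction j) (simp_all add: b assms(2,3))
  then show "b \<in> reversible_part M \<Phi> \<Phi>s"
    using b assms(1,4,5) by (auto simp: reversible_part_def)
qed

context schwartz_pair
begin

abbreviation "D \<equiv> reversible_part M \<Phi> \<Phi>s"

lemma D_infinity_eq_reversible_part: "D_infinity M \<Phi> \<Phi>s = D"
proof -
  have "D_infinity M \<Phi> \<Phi>s =
      (\<Inter>n. multiplicative_domain M (\<Phi> ^^ n)) \<inter> (\<Inter>n. multiplicative_domain M (\<Phi>s ^^ n))"
    (is "?L = ?R")
  proof (intro equalityI subsetI)
    fix a
    assume "a \<in> ?L"
    then have a: "a \<in> multiplicative_domain M (dynamics \<Phi> \<Phi>s k)" for k
      by (auto simp: D_infinity_def)
    \<comment> \<open>For \<open>n = 0\<close> the negative index is 0 too, and both families give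
      the identity there.\<close>
    have "dynamics \<Phi> \<Phi>s (int n) = \<Phi> ^^ n" "dynamics \<Phi> \<Phi>s (- int n) = \<Phi>s ^^ n" for n
      by (auto simp: dynamics_def)
    then have "a \<in> multiplicative_domain M (\<Phi> ^^ n)" "a \<in> multiplicative_domain M (\<Phi>s ^^ n)" for n
      using a by metis+
    then show "a \<in> ?R"
      by blast
  qed (auto simp: D_infinity_def dynamics_def)
  also have "\<dots> = D"
    unfolding multiplicative_domain_funpow schwartz_pair.multiplicative_domain_funpow[OF swap]
    by (auto simp: reversible_part_def)
  finally show ?thesis .
qed

lemma D_subset: "D \<subseteq> M"
  by (auto simp: reversible_part_def)

lemma D_inverse: "d \<in> D \<Longrightarrow> \<Phi>s (\<Phi> d) = d" "d \<in> D \<Longrightarrow> \<Phi> (\<Phi>s d) = d"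
  unfolding reversible_part_def by (auto dest: spec[of _ 0])

text \<open>The forward orbit of \<open>\<Phi> d\<close> is a shift of that of \<open>d\<close>. On
  the backward orbit the first \<open>\<Phi>s\<close> cancels \<Phi>, leaving the backward orbit of
  \<open>d\<close> after the initial point.\<close>

lemma D_map:
  assumes d: "d \<in> D"
  shows "\<Phi> d \<in> D"
proof -
  have "\<Phi>s (\<Phi> ((\<Phi> ^^ Suc j) d)) = (\<Phi> ^^ Suc j) d" for j
    using d by (simp add: reversible_part_def del: funpow.simps)
  then have "\<Phi>s (\<Phi> ((\<Phi> ^^ j) (\<Phi> d))) = (\<Phi> ^^ j) (\<Phi> d)" for j
    by (simp add: funpow_Suc_right del: funpow.simps)
  moreover have "\<Phi> (\<Phi>s ((\<Phi>s ^^ j) (\<Phi> d))) = (\<Phi>s ^^ j) (\<Phi> d)" for j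
  proof (cases j)
    case 0
    then show ?thesis
      by (simp add: D_inverse(1)[OF d])
  next
    case (Suc i)
    then have "(\<Phi>s ^^ j) (\<Phi> d) = (\<Phi>s ^^ i) d"
      by (simp add: funpow_swap1 D_inverse(1)[OF d])
    then show ?thesis
      using d by (simp add: reversible_part_def)
  qed
  ultimately show ?thesis
    using d by (simp add: reversible_part_def map_mem)
qed

lemma D_map': "d \<in> D \<Longrightarrow> \<Phi>s d \<in> D"
  using schwartz_pair.D_map[OF swap] by (simp add: reversible_part_commute)

lemma D_mult: "a \<in> D \<Longrightarrow> b \<in> D \<Longrightarrow> \<Phi> (a * b) = \<Phi> a * \<Phi> b"
  using D_subset D_inverse(1) by (intro map_mult) auto

lemma D_mult': "a \<in> D \<Longrightarrow> b \<in> D \<Longrightarrow> \<Phi>s (a * b) = \<Phi>s a * \<Phi>s b"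
  using schwartz_pair.D_mult[OF swap] by (simp add: reversible_part_commute)

text \<open>For each operation, the set of its results on \<open>D\<close> is invariant under both
  maps, which are inverse on it; maximality puts this set inside \<open>D\<close>.\<close>

lemma D_subalgebra: "unital_star_subalgebra D"
proof -
  have sub: "d \<in> M" if "d \<in> D" for d
    using D_subset that by blast
  note add' = schwartz_pair.map_add[OF swap] and scaleC' = schwartz_pair.map_scaleC[OF swap]
  have "{1} \<subseteq> D"
    by (rule reversible_part_greatest) (auto simp: map_one mem)
  moreover have "{a + b | a b. a \<in> D \<and> b \<in> D} \<subseteq> D"
    by (rule reversible_part_greatest; auto simp: map_add add' map_mem mem sub D_inverse D_map D_map'; blast intro: D_map D_map')
  moreover have "{a * b | a b. a \<in> D \<and> b \<in> D} \<subseteq> D"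
    by (rule reversible_part_greatest; auto simp: D_mult D_mult' mem sub D_inverse D_map D_map'; blast intro: D_map D_map')
  moreover have "{c *\<^sub>C a | a c. a \<in> D} \<subseteq> D"
    by (rule reversible_part_greatest; auto simp: map_scaleC scaleC' map_mem mem sub D_inverse D_map D_map'; blast intro: D_map D_map')
  moreover have "adj ` D \<subseteq> D"
    by (rule reversible_part_greatest; auto simp: map_adj map_mem mem sub D_inverse D_map D_map'; blast intro: D_map D_map')
  ultimately show ?thesis
    unfolding unital_star_subalgebra_def by blast
qed

text \<open>\<open>D\<close> is the solution set in \<open>M\<close> of equations between iterates
  of ultraweakly continuous maps, and such equations extend from \<open>D\<close> to its
  bicommutant.\<close>

lemma D_von_neumann: "von_neumann_algebra D"
  unfolding von_neumann_algebra_def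
proof (intro conjI ballI equalityI subset_double_commutant subsetI)
  show "adj d \<in> D" if "d \<in> D" for d
    using unital_star_subalgebraD(5)[OF D_subalgebra that] .
  fix a
  assume a: "a \<in> commutant (commutant D)"
  let ?T = "subtopology ultraweak_topology M"
  have "continuous_map ?T ?T \<Phi>" "continuous_map ?T ?T \<Phi>s"
    using schwartz schwartz' by (simp_all add: unital_schwartz_map_def)
  moreover from this have "continuous_map ?T ?T (\<Phi> ^^ j)" "continuous_map ?T ?T (\<Phi>s ^^ j)" for j
    by (induction j; simp add: continuous_map_compose)+
  ultimately have "continuous_map ?T ?T (\<Phi> ^^ j)" "continuous_map ?T ?T (\<Phi>s \<circ> \<Phi> \<circ> (\<Phi> ^^ j))"
    and "continuous_map ?T ?T (\<Phi>s ^^ j)" "continuous_map ?T ?T (\<Phi> \<circ> \<Phi>s \<circ> (\<Phi>s ^^ j))" for j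
    by (blast intro: continuous_map_compose)+
  note ext = ultraweak_equalizer_double_commutant[OF von_neumann D_subalgebra D_subset _ _ _ a]
  have "a \<in> M"
    \<comment> \<open>The trivial equation \<open>id = id\<close> is enough to obtain membership in
      \<open>M\<close>.\<close>
    by (rule ext(1)[of id id]) simp_all
  moreover have "(\<Phi>s \<circ> \<Phi> \<circ> (\<Phi> ^^ j)) a = (\<Phi> ^^ j) a" "(\<Phi> \<circ> \<Phi>s \<circ> (\<Phi>s ^^ j)) a = (\<Phi>s ^^ j) a" for j
    by (rule ext(2)[where F = "\<Phi>s \<circ> \<Phi> \<circ> (\<Phi> ^^ j)"] ext(2)[where F = "\<Phi> \<circ> \<Phi>s \<circ> (\<Phi>s ^^ j)"];
        (fact | simp add: reversible_part_def))+
  ultimately show "a \<in> D"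
    by (simp add: reversible_part_def)
qed

lemma D_star_automorphism: "star_automorphism D (restrict \<Phi> D)"
proof -
  have sub: "d \<in> M" if "d \<in> D" for d
    using D_subset that by blast
  have "bij_betw \<Phi> D D"
    by (rule bij_betw_byWitness[where f' = \<Phi>s]) (auto simp: D_inverse D_map D_map')
  then have "bij_betw (restrict \<Phi> D) D D"
    by (simp cong: bij_betw_cong)
  then show ?thesis
    using unital_star_subalgebraD[OF D_subalgebra]
    by (simp add: star_automorphism_def clinear_on_def map_add map_scaleC map_adj D_mult sub)
qed

text \<open>Multiplicativity on \<open>B\<close> gives equality in the Schwartz inequality, so
  \<open>\<Phi>s\<close> undoes \<Phi> there. Surjectivity of \<Phi> on \<open>B\<close> then gives
  invariance under \<open>\<Phi>s\<close> and the other inverse law.\<close>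

lemma star_automorphism_subset_D:
  assumes B: "von_neumann_algebra B" "B \<subseteq> M" and auto: "star_automorphism B (restrict \<Phi> B)"
  shows "B \<subseteq> D"
proof (rule reversible_part_greatest[OF B(2)])
  note memB = unital_star_subalgebraD[OF von_neumann_algebra_imp_unital_star_subalgebra[OF B(1)]]
  have bij: "bij_betw \<Phi> B B"
    using auto by (simp add: star_automorphism_def cong: bij_betw_cong)
  have mult: "\<Phi> (a * b) = \<Phi> a * \<Phi> b" if "a \<in> B" "b \<in> B" for a b
    using auto that by (simp add: star_automorphism_def memB)
  show map: "\<Phi> b \<in> B" if "b \<in> B" for b
    using bij that by (auto simp: bij_betw_def)
  show inv: "\<Phi>s (\<Phi> b) = b" if "b \<in> B" for b
    using that B(2) by (auto simp: adjoint_map_eq_iff mult memB map_adj)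
  show "\<Phi>s b \<in> B" "\<Phi> (\<Phi>s b) = b" if b: "b \<in> B" for b
  proof -
    obtain c where "c \<in> B" "b = \<Phi> c"
      using bij b by (auto simp: bij_betw_def)
    then show "\<Phi>s b \<in> B" "\<Phi> (\<Phi>s b) = b"
      by (simp_all add: inv)
  qed
qed

end

section \<open>Restriction to the reversible part and uniqueness of the adjoint\<close>

lemma continuous_map_restrict_subtopology:
  assumes "continuous_map (subtopology X M) Y f" and "N \<subseteq> M"
  shows "continuous_map (subtopology X N) Y (restrict f N)"
  by (rule continuous_map_eq[OF continuous_map_from_subtopology_mono[OF assms]]) simp

lemma unital_schwartz_map_restrict:
  assumes N: "unital_star_subalgebra N" "N \<subseteq> M" and \<Phi>: "unital_schwartz_map M \<Phi>" "\<Phi> \<in> N \<rightarrow> N"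
  shows "unital_schwartz_map N (restrict \<Phi> N)"
proof -
  note mem = unital_star_subalgebraD[OF N(1)]
  have sub: "a \<in> M" if "a \<in> N" for a
    using that N(2) by blast
  have "continuous_map (subtopology ultraweak_topology M) ultraweak_topology \<Phi>"
    using \<Phi>(1) unfolding unital_schwartz_map_def by (elim conjE) (rule continuous_map_into_fulltopology)
  then have "continuous_map (subtopology ultraweak_topology N) ultraweak_topology (restrict \<Phi> N)"
    using N(2) by (rule continuous_map_restrict_subtopology)
  then have "continuous_map (subtopology ultraweak_topology N) (subtopology ultraweak_topology N) (restrict \<Phi> N)"
    using \<Phi>(2) by (auto simp: continuous_map_in_subtopology)
  then show ?thesis
    using \<Phi> by (simp add: unital_schwartz_map_def clinear_on_def mem sub Pi_iff)
qed

lemma normal_faithful_state_restrict: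
  assumes N: "unital_star_subalgebra N" "N \<subseteq> M" and \<phi>: "normal_faithful_state M \<phi>"
  shows "normal_faithful_state N (restrict \<phi> N)"
proof -
  note mem = unital_star_subalgebraD[OF N(1)]
  have sub: "a \<in> M" if "a \<in> N" for a
    using that N(2) by blast
  have "continuous_map (subtopology ultraweak_topology M) euclidean \<phi>"
    using \<phi> by (simp add: normal_faithful_state_def)
  then have "continuous_map (subtopology ultraweak_topology N) euclidean (restrict \<phi> N)"
    using N(2) by (rule continuous_map_restrict_subtopology)
  then show ?thesis
    using \<phi> by (simp add: normal_faithful_state_def clinear_on_def mem sub)
qed

theorem proposition5:
  fixes M :: "'h::chilbert_space bop set"
    and \<Phi> \<Phi>s :: "'h bop \<Rightarrow> 'h bop"
    and \<phi> :: "'h bop \<Rightarrow> complex"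
    and D :: "'h bop set"
  assumes "quantum_dynamical_system M \<Phi> \<phi>"
    and "state_adjoint M \<Phi> \<phi> \<Phi>s"
    and "D = D_infinity M \<Phi> \<Phi>s"
  shows "(von_neumann_algebra D \<and> \<Phi> ` D \<subseteq> D \<and> star_automorphism D (restrict \<Phi> D)) \<and>
    (\<forall>B. von_neumann_algebra B \<and> B \<subseteq> M \<and> star_automorphism B (restrict \<Phi> B) \<longrightarrow> B \<subseteq> D) \<and>
    (quantum_dynamical_system D (restrict \<Phi> D) (restrict \<phi> D) \<and>
      state_adjoint D (restrict \<Phi> D) (restrict \<phi> D) (restrict \<Phi>s D) \<and>
      (\<forall>\<Psi>. state_adjoint D (restrict \<Phi> D) (restrict \<phi> D) \<Psi> \<longrightarrow> (\<forall>d\<in>D. \<Psi> d = \<Phi>s d)))"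
proof -
  interpret P: schwartz_pair M \<Phi> \<Phi>s \<phi>
    using assms(1,2) by unfold_locales (auto simp: quantum_dynamical_system_def state_adjoint_def)
  have D: "D = P.D"
    by (simp add: assms(3) P.D_infinity_eq_reversible_part)
  note alg = P.D_subalgebra[folded D] and subset = P.D_subset[folded D]
  note mem = unital_star_subalgebraD[OF alg] and map = P.D_map[folded D] P.D_map'[folded D]
  have sub: "d \<in> M" if "d \<in> D" for d
    using that subset by blast
  have schwartz: "unital_schwartz_map D (restrict \<Phi> D)" "unital_schwartz_map D (restrict \<Phi>s D)"
    using map by (auto intro!: unital_schwartz_map_restrict[OF alg subset] P.schwartz P.schwartz')
  have adjoint: "state_adjoint D (restrict \<Phi> D) (restrict \<phi> D) (restrict \<Phi>s D)"
    using schwartz(2) by (simp add: state_adjoint_def map mem sub P.adjoint)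
  have "quantum_dynamical_system D (restrict \<Phi> D) (restrict \<phi> D)"
    using P.D_von_neumann[folded D] schwartz(1) adjoint normal_faithful_state_restrict[OF alg subset P.state]
    by (auto simp: quantum_dynamical_system_def map sub P.state_invariant)
  moreover have "\<Psi> d = \<Phi>s d"
    if \<Psi>: "state_adjoint D (restrict \<Phi> D) (restrict \<phi> D) \<Psi>" and d: "d \<in> D" for \<Psi> d
  proof -
    have \<Psi>d: "\<Psi> d \<in> D"
      using \<Psi> d by (auto simp: state_adjoint_def unital_schwartz_map_def)
    have "\<phi> (\<Psi> d * a) = \<phi> (\<Phi>s d * a)" if a: "a \<in> D" for a
    proof -
      have "\<phi> (\<Psi> d * a) = \<phi> (d * \<Phi> a)"
        using \<Psi> d a \<Psi>d by (simp add: state_adjoint_def mem map)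
      then show ?thesis
        using a d by (simp add: P.adjoint sub)
    qed
    \<comment> \<open>The test element in \<open>state_separating\<close> stands on the left, so the
      pairings are reversed by taking adjoints before that lemma is applied inside
      \<open>D\<close>.\<close>
    then have "\<phi> (adj (\<Psi> d * a)) = \<phi> (adj (\<Phi>s d * a))" if "a \<in> D" for a
      using that d \<Psi>d by (simp add: P.state_adj mem map sub)
    then have "\<phi> (adj a * adj (\<Psi> d)) = \<phi> (adj a * adj (\<Phi>s d))" if "a \<in> D" for a
      using that by (simp add: adj_mult)
    then have "adj (\<Psi> d) = adj (\<Phi>s d)"
      using d \<Psi>d by (intro P.state_separating) (simp_all add: mem map sub)
    then show ?thesis
      by (metis adj_adj)
  qed
  ultimately show ?thesis
    using P.D_von_neumann[folded D] P.D_star_automorphism[folded D] P.star_automorphism_subset_D[folded D]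
      map(1) adjoint by blast
qed

end
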